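(* Let $k\ge 1$ and let $s_1,\ldots,s_k\ge 3$ be fixed integers, and put $S=\sum_{i=1}^{k}(s_i-2)$. Suppose that for each $1\le i\le k$ there exist weakly optimal $K_{s_i}$-free $(n,d,\lambda)$-graphs for all $n$, with parameter of weak optimality $\alpha_i>0$. Then, as $t\to\infty$, \[ \Omega\Big(\frac{t^{S+1}}{\log^{2S}t}\Big)\le r(s_{1},\ldots,s_{k},t)\le O\Big(\frac{t^{S+1}}{\log^{S}t}\Big), \] where the implicit constants may depend only on $S$ and on $\alpha_1,\ldots,\alpha_k$. That is, there are constants $c,C>0$ and $t_0$, depending only on $S,\alpha_1,\ldots,\alpha_k$, such that $c\,t^{S+1}/(\log t)^{2S}\le r(s_1,\ldots,s_k,t)\le C\,t^{S+1}/(\log t)^{S}$ for all integers $t\ge t_0$.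
   Context: Graphs are finite and simple; $\log$ is the natural logarithm. Ramsey number: $r(m_1,\ldots,m_\ell)$ is the smallest positive integer $N$ such that in every coloring of the edges of the complete graph $K_N$ with $\ell$ colors $1,\ldots,\ell$ there is, for some color $j\in\{1,\ldots,\ell\}$, a copy of $K_{m_j}$ all of whose edges have color $j$. Thus $r(s_1,\ldots,s_k,t)$ concerns colorings with $k+1$ colors. An $(n,d,\lambda)$-graph is a $d$-regular graph on $n$ vertices all of whose nontrivial adjacency eigenvalues have absolute value at most $\lambda$; i.e., if the adjacency eigenvalues with multiplicity are $d=\mu_1\ge\mu_2\ge\cdots\ge\mu_n$, then $|\mu_j|\le\lambda$ for all $j\ge2$. For $s\ge 3$, a family of weakly optimal $K_s$-free $(n,d,\lambda)$-graphs with parameter of weak optimality $\alpha>0$ is a collection of $K_s$-free $(n_i,d_i,\lambda_i)$-graphs for which $d_i=\Theta(n_i^{1-\alpha})$ and $\lambda_i=\Theta(n_i^{1-(s-1)\alpha})$ as $n_i\to\infty$, where $\alpha>0$ is fixed and $\alpha$ and the implicit constants do not depend on $i$. Saying that weakly optimal $K_s$-free $(n,d,\lambda)$-graphs exist for all $n$ (with parameter $\alpha$) means that there is such a family containing a graph on $n$ vertices for every positive integer $n$: for each $n$ there is a $K_s$-free $(n,d(n),\lambda(n))$-graph, with $d(n)=\Theta(n^{1-\alpha})$ and $\lambda(n)=\Theta(n^{1-(s-1)\alpha})$ as $n\to\infty$. *)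

theory Defs
  imports
    "HOL-Analysis.Analysis"
    "HOL-Library.Ramsey"
    "HOL-Library.Landau_Symbols"
    "Jordan_Normal_Form.Char_Poly"
begin

(* partn_lst (from HOL-Library.Ramsey) numbers the colors from 0: every coloring of the
   2-subsets of {..<N} with colors 0, ..., length ms - 1 has, for some color j, a set of
   size ms ! j all of whose 2-subsets have color j. *)
definition ramsey_number :: "nat list \<Rightarrow> nat" where
  "ramsey_number ms = (LEAST N. N > 0 \<and> partn_lst {..<N} ms 2)"

(* A finite simple graph on n vertices is represented by its edge set, a set of 2-subsets
   of {..<n}; up to isomorphism this covers all such graphs. *)
definition graph_on :: "nat \<Rightarrow> nat set set \<Rightarrow> bool" where
  "graph_on n E \<longleftrightarrow> E \<subseteq> nsets {..<n} 2"

definition regular_graph :: "nat \<Rightarrow> nat \<Rightarrow> nat set set \<Rightarrow> bool" where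
  "regular_graph n d E \<longleftrightarrow> graph_on n E \<and> (\<forall>v<n. card {e \<in> E. v \<in> e} = d)"

definition clique_free :: "nat \<Rightarrow> nat \<Rightarrow> nat set set \<Rightarrow> bool" where
  "clique_free s n E \<longleftrightarrow> \<not> (\<exists>H \<in> nsets {..<n} s. clique H E)"

definition adjacency_matrix :: "nat \<Rightarrow> nat set set \<Rightarrow> real mat" where
  "adjacency_matrix n E = mat n n (\<lambda>(i, j). if {i, j} \<in> E then 1 else 0)"

(* The list of all adjacency eigenvalues with multiplicity, in decreasing order. *)
definition adjacency_spectrum :: "nat \<Rightarrow> nat set set \<Rightarrow> real list \<Rightarrow> bool" where
  "adjacency_spectrum n E \<mu> \<longleftrightarrow>
     length \<mu> = n \<and> sorted_wrt (\<ge>) \<mu> \<and>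
     char_poly (adjacency_matrix n E) = (\<Prod>x\<leftarrow>\<mu>. [:- x, 1:])"

definition ndl_graph :: "nat \<Rightarrow> nat \<Rightarrow> real \<Rightarrow> nat set set \<Rightarrow> bool" where
  "ndl_graph n d l E \<longleftrightarrow>
     regular_graph n d E \<and>
     (\<exists>\<mu>. adjacency_spectrum n E \<mu> \<and> \<mu> ! 0 = real d \<and> (\<forall>j\<in>{1..<n}. \<bar>\<mu> ! j\<bar> \<le> l))"

definition weakly_optimal_graphs_for_all_n :: "nat \<Rightarrow> real \<Rightarrow> bool" where
  "weakly_optimal_graphs_for_all_n s \<alpha> \<longleftrightarrow>
     (\<exists>(E :: nat \<Rightarrow> nat set set) (d :: nat \<Rightarrow> nat) (l :: nat \<Rightarrow> real).
        (\<forall>n\<ge>1. ndl_graph n (d n) (l n) (E n) \<and> clique_free s n (E n)) \<and>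
        (\<lambda>n. real (d n)) \<in> \<Theta>(\<lambda>n. real n powr (1 - \<alpha>)) \<and>
        l \<in> \<Theta>(\<lambda>n. real n powr (1 - (real s - 1) * \<alpha>)))"

end

theory Submission
  imports Defs "Jordan_Normal_Form.Schur_Decomposition" "HOL-Real_Asymp.Real_Asymp"
begin

text \<open>Upper bound: by induction on \<open>S\<close>. In a colouring with no forbidden clique, let \<open>G\<close> be the graph
  of the edges with one of the first \<open>k\<close> colours. A colour neighbourhood avoids a shorter list, so \<open>G\<close>
  has degree \<open>O(t^S / ln^(S-1) t)\<close>, and neighbourhoods of \<open>G\<close> are sparser by a factor \<open>ln t / t\<close>,
  since their edges are counted by sets that are restricted twice. The hard-core model at a small
  fugacity then yields an independent set that is larger by a factor \<open>ln t\<close> than the trivial one.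

  Lower bound: map the \<open>N\<close> vertices at random to each of the \<open>k\<close> pseudorandom graphs and give a pair
  the first colour for which its image is an edge. A set of \<open>t\<close> vertices that sees none of these
  colours has an independent image in every graph, and by the expander mixing lemma an
  \<open>(n,d,\<lambda>)\<close>-graph has at most \<open>(O(\<lambda> n / d))^t\<close> independent \<open>t\<close>-tuples once \<open>t\<close> is about
  \<open>(n / d) ln^2 n\<close> (Alon and Roedl).\<close>

section \<open>Expander mixing\<close>

text \<open>The two powers of the logarithm have different origins. In the upper bound, degree at
  most \<open>D\<close> alone gives an independent set of order \<open>card V / D\<close>, which
  would lose one logarithm in every step of the induction. Since neighbourhoods have average degree
  \<open>M\<close> of order at most \<open>D ln t / t\<close>, the fugacity can be as large as
  \<open>1 / (4 M)\<close>, and the gain is \<open>ln (D / (4 M))\<close>, which is of order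
  \<open>ln t\<close>. In the lower bound, the count of independent tuples carries an error
  \<open>exp (O(n^\<alpha> ln^2 n))\<close>, harmless only if it is \<open>exp (O(t))\<close>. This
  forces \<open>n^\<alpha>\<close> to be about \<open>t / ln^2 t\<close>, so a random map leaves a
  given \<open>t\<close>-set independent with probability at most
  \<open>(O(ln^2 t / t))^((s-2) t)\<close>. Over all colours this is
  \<open>(O(ln^2 t / t))^(S t)\<close>, and against \<open>(e N / t)^t\<close> sets it allows
  \<open>N\<close> of order \<open>t^(S+1) / ln^(2S) t\<close>. Probabilities appear as averages of
  finite sums. The constants must not depend on the list \<open>s\<close>, while both bounds produce
  constants per list; for fixed \<open>k\<close> and \<open>S\<close> only finitely many lists are
  possible.\<close>

lemma index_mult_mat_sum:
  assumes "A \<in> carrier_mat n m" "B \<in> carrier_mat m p" "i < n" "j < p"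
  shows "(A * B) $$ (i, j) = (\<Sum>l<m. A $$ (i, l) * B $$ (l, j))"
  using assms by (auto simp: scalar_prod_def atLeast0LessThan)

lemma sum_diag_mult_commute:
  fixes A B :: "'a :: comm_ring_1 mat"
  assumes "A \<in> carrier_mat n m" "B \<in> carrier_mat m n"
  shows "(\<Sum>i<n. (A * B) $$ (i, i)) = (\<Sum>i<m. (B * A) $$ (i, i))"
proof -
  have "(\<Sum>i<n. (A * B) $$ (i, i)) = (\<Sum>i<n. \<Sum>l<m. A $$ (i, l) * B $$ (l, i))"
    by (intro sum.cong refl index_mult_mat_sum[OF assms]) auto
  also have "\<dots> = (\<Sum>l<m. \<Sum>i<n. B $$ (l, i) * A $$ (i, l))"
    by (subst sum.swap) (simp add: mult.commute)
  also have "\<dots> = (\<Sum>i<m. (B * A) $$ (i, i))"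
    by (intro sum.cong refl index_mult_mat_sum[OF assms(2,1), symmetric]) auto
  finally show ?thesis .
qed

lemma upper_triangular_mult_diag:
  fixes A B :: "'a :: comm_ring_1 mat"
  assumes "A \<in> carrier_mat n n" "B \<in> carrier_mat n n" "upper_triangular A" "upper_triangular B"
  shows "upper_triangular (A * B)" "i < n \<Longrightarrow> (A * B) $$ (i, i) = A $$ (i, i) * B $$ (i, i)"
proof -
  have *: "A $$ (i, l) * B $$ (l, j) = 0" if "i < n" "l < n" "j < n" "l < i \<or> j < l" for i j l
    using that assms unfolding upper_triangular_def by auto
  show "upper_triangular (A * B)"
  proof (rule upper_triangularI)
    fix i j assume "j < i" "i < dim_row (A * B)"
    then have ij: "j < i" "i < n" using assms by auto
    have "(A * B) $$ (i, j) = (\<Sum>l<n. A $$ (i, l) * B $$ (l, j))"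
      using ij by (intro index_mult_mat_sum[OF assms(1,2)]) auto
    also have "\<dots> = 0" using ij * by (intro sum.neutral) (metis lessThan_iff less_trans linorder_neqE_nat)
    finally show "(A * B) $$ (i, j) = 0" .
  qed
  assume i: "i < n"
  have "(A * B) $$ (i, i) = (\<Sum>l<n. A $$ (i, l) * B $$ (l, i))"
    using i by (intro index_mult_mat_sum[OF assms(1,2)]) auto
  also have "\<dots> = (\<Sum>l\<in>{i}. A $$ (i, l) * B $$ (l, i))"
    using i * by (intro sum.mono_neutral_right) (auto simp: nat_neq_iff)
  finally show "(A * B) $$ (i, i) = A $$ (i, i) * B $$ (i, i)" by simp
qed

lemma upper_triangular_pow_diag:
  fixes A :: "'a :: comm_ring_1 mat"
  assumes A: "A \<in> carrier_mat n n" "upper_triangular A"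
  shows "upper_triangular (A ^\<^sub>m k) \<and> (\<forall>i<n. (A ^\<^sub>m k) $$ (i, i) = (A $$ (i, i)) ^ k)"
proof (induction k)
  case 0 then show ?case using A by (auto intro!: upper_triangularI)
next
  case (Suc k)
  have c: "A ^\<^sub>m k \<in> carrier_mat n n" using A by simp
  show ?case
    using Suc upper_triangular_mult_diag[OF c A(1) _ A(2)] by (auto simp: mult.commute)
qed

text \<open>A Schur decomposition makes \<open>A\<close> similar to an upper triangular matrix with
  diagonal \<open>\<mu>\<close>. Powers act entrywise on such a diagonal, and the trace is invariant
  under the similarity.\<close>

lemma sum_diag_pow_eq_sum_eigenvalues:
  fixes A :: "'a :: conjugatable_ordered_field mat"
  assumes A: "A \<in> carrier_mat n n" and char: "char_poly A = (\<Prod>x\<leftarrow>\<mu>. [:- x, 1:])"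
    and len: "length \<mu> = n"
  shows "(\<Sum>i<n. (A ^\<^sub>m k) $$ (i, i)) = (\<Sum>i<n. (\<mu> ! i) ^ k)"
proof -
  obtain B P Q where S: "schur_decomposition A \<mu> = (B, P, Q)" by (metis prod_cases3)
  from schur_decomposition[OF A char S] have sim: "similar_mat_wit A B P Q"
    and ut: "upper_triangular B" and diag: "diag_mat B = \<mu>" by auto
  from similar_mat_witD2[OF A sim] have c: "B \<in> carrier_mat n n" "P \<in> carrier_mat n n"
    "Q \<in> carrier_mat n n" and QP: "Q * P = 1\<^sub>m n" by auto
  have Bk: "B ^\<^sub>m k \<in> carrier_mat n n" using c by simp
  have "A ^\<^sub>m k = P * (B ^\<^sub>m k) * Q" by (rule similar_mat_wit_pow_id[OF sim])
  also have "\<dots> = P * ((B ^\<^sub>m k) * Q)" using c Bk by (intro assoc_mult_mat) auto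
  finally have Ak: "A ^\<^sub>m k = P * ((B ^\<^sub>m k) * Q)" .
  have "(\<Sum>i<n. (A ^\<^sub>m k) $$ (i, i)) = (\<Sum>i<n. ((B ^\<^sub>m k) * Q * P) $$ (i, i))"
    unfolding Ak using c Bk by (intro sum_diag_mult_commute) auto
  also have "(B ^\<^sub>m k) * Q * P = B ^\<^sub>m k"
    using assoc_mult_mat[OF Bk c(3,2)] QP right_mult_one_mat[OF Bk] by simp
  also have "(\<Sum>i<n. (B ^\<^sub>m k) $$ (i, i)) = (\<Sum>i<n. (\<mu> ! i) ^ k)"
    using upper_triangular_pow_diag[OF c(1) ut] diag c by (auto simp: diag_mat_def)
  finally show ?thesis .
qed

text \<open>By log-convexity the ratios of consecutive terms never decrease. If the first ratio
  \<open>q\<close> exceeded \<open>r\<close>, the sequence would grow at least like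
  \<open>q ^ m\<close> and overtake \<open>c * r ^ m\<close>, whatever \<open>c\<close> is.\<close>

lemma log_convex_growth_bound:
  fixes a :: "nat \<Rightarrow> real"
  assumes nonneg: "\<And>m. 0 \<le> a m" and convex: "\<And>m. (a (Suc m))\<^sup>2 \<le> a m * a (Suc (Suc m))"
    and bound: "\<And>m. a m \<le> c * r ^ m" and r: "0 \<le> r"
  shows "a 1 \<le> r * a 0"
proof (rule ccontr)
  assume "\<not> a 1 \<le> r * a 0"
  then have gt: "r * a 0 < a 1" by simp
  have a0: "a 0 > 0"
  proof (rule ccontr)
    assume "\<not> a 0 > 0"
    then have "a 0 = 0" using nonneg[of 0] by simp
    then show False using convex[of 0] gt by simp
  qed
  define q where "q = a 1 / a 0"
  have q: "r < q" using gt a0 by (simp add: q_def field_simps)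
  have step: "a m > 0 \<and> q * a m \<le> a (Suc m)" for m
  proof (induction m)
    case 0 then show ?case using a0 by (simp add: q_def)
  next
    case (Suc m)
    have pos: "a (Suc m) > 0" using Suc q r by (meson less_le_trans mult_pos_pos le_less_trans)
    have "q * a (Suc m) * a m \<le> a (Suc m) * a (Suc m)" using Suc pos by (simp add: mult.assoc mult.left_commute)
    also have "\<dots> \<le> a (Suc (Suc m)) * a m" using convex[of m] by (simp add: power2_eq_square mult.commute)
    finally show ?case using pos Suc by simp
  qed
  have grow: "q ^ m * a 0 \<le> a m" for m
  proof (induction m)
    case (Suc m)
    have "q ^ Suc m * a 0 \<le> q * a m" using Suc q r by (simp add: mult.assoc)
    then show ?case using step[of m] by linarith
  qed simp
  have "(\<lambda>m. c * (r / q) ^ m) \<longlonglongrightarrow> c * 0"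
    using q r by (intro tendsto_intros LIMSEQ_power_zero) auto
  then have "eventually (\<lambda>m. c * (r / q) ^ m < a 0) sequentially"
    using a0 by (auto elim!: order_tendstoD(2))
  then obtain m where m: "c * (r / q) ^ m < a 0" by (auto simp: eventually_sequentially)
  have qm: "q ^ m > 0" using q r by simp
  have "c * r ^ m < a 0 * q ^ m" using m qm by (simp add: power_divide field_simps)
  then show False using grow[of m] bound[of m] by (simp add: mult.commute)
qed

text \<open>Trace method: for \<open>x\<close> with zero sum, \<open>|A^k x|^2 \<le> (tr A^(2k) - d^(2k)) |x|^2 \<le> n l^(2k) |x|^2\<close>,
  and log-convexity of \<open>|A^k x|^2\<close> in \<open>k\<close> removes the factor \<open>n\<close> at \<open>k = 1\<close>. This avoids an
  orthonormal eigenbasis; only the multiset of eigenvalues enters.\<close>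
lemma contraction_on_constants_complement:
  fixes A :: "real mat" and x :: "nat \<Rightarrow> real"
  assumes A: "A \<in> carrier_mat n n"
    and sym: "\<And>i j. i < n \<Longrightarrow> j < n \<Longrightarrow> A $$ (i, j) = A $$ (j, i)"
    and rows: "\<And>i. i < n \<Longrightarrow> (\<Sum>j<n. A $$ (i, j)) = d"
    and char: "char_poly A = (\<Prod>y\<leftarrow>\<mu>. [:- y, 1:])" and len: "length \<mu> = n"
    and top: "\<mu> ! 0 = d" and small: "\<And>j. 1 \<le> j \<Longrightarrow> j < n \<Longrightarrow> \<bar>\<mu> ! j\<bar> \<le> l"
    and n: "n \<ge> 1" and x: "(\<Sum>j<n. x j) = 0"
  shows "(\<Sum>i<n. (\<Sum>j<n. A $$ (i, j) * x j)\<^sup>2) \<le> l\<^sup>2 * (\<Sum>i<n. (x i)\<^sup>2)"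
proof -
  have Ac: "A ^\<^sub>m k \<in> carrier_mat n n" for k using A by simp
  have comm: "A ^\<^sub>m k * A = A * A ^\<^sub>m k" for k
  proof (induction k)
    case (Suc k)
    then show ?case using A Ac by (simp add: assoc_mult_mat[of _ n n _ n _ n] del: pow_mat.simps) 
        (simp add: assoc_mult_mat[of _ n n _ n _ n])
  qed (use A in auto)
  have powR: "(A ^\<^sub>m Suc k) $$ (i, j) = (\<Sum>h<n. (A ^\<^sub>m k) $$ (i, h) * A $$ (h, j))"
    if "i < n" "j < n" for i j k
    using index_mult_mat_sum[OF Ac A that] by simp
  have powL: "(A ^\<^sub>m Suc k) $$ (i, j) = (\<Sum>h<n. A $$ (i, h) * (A ^\<^sub>m k) $$ (h, j))"
    if "i < n" "j < n" for i j k
    using index_mult_mat_sum[OF A Ac that] comm by simp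
  have symk: "(A ^\<^sub>m k) $$ (i, j) = (A ^\<^sub>m k) $$ (j, i)" if "i < n" "j < n" for i j k
    using that
  proof (induction k arbitrary: i j)
    case (Suc k)
    then show ?case unfolding powR[OF Suc.prems] powL[OF Suc.prems(2,1)]
      by (intro sum.cong) (auto simp: sym mult.commute)
  qed (use A in auto)
  have rowk: "(\<Sum>j<n. (A ^\<^sub>m k) $$ (i, j)) = d ^ k" if "i < n" for i k
    using that
  proof (induction k arbitrary: i)
    case 0
    have "(\<Sum>j<n. (1\<^sub>m n) $$ (i, j)) = (\<Sum>j<n. if i = j then 1 else (0::real))"
      using 0 by (intro sum.cong) auto
    then show ?case using A 0 by (simp add: sum.delta)
  next
    case (Suc k)
    have "(\<Sum>j<n. (A ^\<^sub>m Suc k) $$ (i, j)) = (\<Sum>h<n. A $$ (i, h) * (\<Sum>j<n. (A ^\<^sub>m k) $$ (h, j)))"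
      using Suc.prems by (simp add: powL sum_distrib_left del: pow_mat.simps) (rule sum.swap)
    also have "\<dots> = (\<Sum>h<n. A $$ (i, h) * d ^ k)" using Suc.IH by (intro sum.cong) auto
    also have "\<dots> = d ^ Suc k" using rows[OF Suc.prems] by (simp flip: sum_distrib_right)
    finally show ?case .
  qed
  \<comment> \<open>By symmetry the squared Frobenius norm of the \<open>k\<close>-th power is the
    trace of the \<open>2k\<close>-th power.\<close>
  have trk: "(\<Sum>i<n. \<Sum>j<n. ((A ^\<^sub>m k) $$ (i, j))\<^sup>2) = (\<Sum>i<n. (\<mu> ! i) ^ (2 * k))" for k
  proof -
    have "A ^\<^sub>m (k + m) = A ^\<^sub>m k * A ^\<^sub>m m" for m
    proof (induction m)
      case (Suc m)
      then show ?case using assoc_mult_mat[OF Ac Ac A, of k m] by simp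
    qed (use A Ac in simp)
    then have "(\<Sum>i<n. (A ^\<^sub>m (2 * k)) $$ (i, i)) = (\<Sum>i<n. \<Sum>j<n. ((A ^\<^sub>m k) $$ (i, j))\<^sup>2)"
      using index_mult_mat_sum[OF Ac Ac, of _ _ k k] symk by (intro sum.cong refl) (auto simp: mult_2 power2_eq_square)
    then show ?thesis using sum_diag_pow_eq_sum_eigenvalues[OF A char len, of "2 * k"] by simp
  qed
  define v where "v k i = (\<Sum>j<n. (A ^\<^sub>m k) $$ (i, j) * x j)" for k i
  define a where "a k = (\<Sum>i<n. (v k i)\<^sup>2)" for k
  have v0: "v 0 i = x i" if "i < n" for i
  proof -
    have "v 0 i = (\<Sum>j<n. if i = j then x j else 0)" unfolding v_def using A that by (intro sum.cong) auto
    then show ?thesis using that by simp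
  qed
  have vSuc: "v (Suc k) i = (\<Sum>h<n. A $$ (i, h) * v k h)" if "i < n" for i k
  proof -
    have "v (Suc k) i = (\<Sum>j<n. \<Sum>h<n. A $$ (i, h) * (A ^\<^sub>m k) $$ (h, j) * x j)"
      using that by (simp add: v_def powL sum_distrib_right del: pow_mat.simps)
    also have "\<dots> = (\<Sum>h<n. A $$ (i, h) * v k h)"
      unfolding v_def sum_distrib_left by (subst sum.swap) (simp add: mult.assoc)
    finally show ?thesis .
  qed
  \<comment> \<open>Symmetry of \<open>A\<close> moves one factor across the inner product;
    Cauchy-Schwarz then gives log-convexity.\<close>
  have "a (Suc k) = (\<Sum>i<n. v k i * v (Suc (Suc k)) i)" for k
  proof -
    have "a (Suc k) = (\<Sum>i<n. \<Sum>h<n. v (Suc k) i * (A $$ (i, h) * v k h))"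
      unfolding a_def power2_eq_square by (intro sum.cong refl) (simp add: vSuc sum_distrib_left)
    also have "\<dots> = (\<Sum>h<n. \<Sum>i<n. v (Suc k) i * (A $$ (i, h) * v k h))" by (rule sum.swap)
    also have "\<dots> = (\<Sum>h<n. v k h * v (Suc (Suc k)) h)"
      by (intro sum.cong refl) (auto simp: vSuc[of _ "Suc k"] sum_distrib_left sym mult_ac intro!: sum.cong)
    finally show ?thesis .
  qed
  then have convex: "(a (Suc k))\<^sup>2 \<le> a k * a (Suc (Suc k))" for k
    using Cauchy_Schwarz_ineq_sum[of "v k" "v (Suc (Suc k))" "{..<n}"] by (simp add: a_def)
  have bound: "a k \<le> (n * (\<Sum>i<n. (x i)\<^sup>2)) * (l\<^sup>2) ^ k" for k
  proof -
    \<comment> \<open>\<open>e\<close> is the mean entry of the \<open>k\<close>-th power.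
      Subtracting it from every entry changes nothing against a vector of zero sum, but removes
      exactly the contribution \<open>d ^ (2 * k)\<close> of the top eigenvalue from the Frobenius
      norm.\<close>
    define e where "e = d ^ k / n"
    have vk: "v k i = (\<Sum>j<n. ((A ^\<^sub>m k) $$ (i, j) - e) * x j)" for i
      using x by (simp add: v_def algebra_simps sum_subtractf flip: sum_distrib_left)
    have "a k \<le> (\<Sum>i<n. (\<Sum>j<n. ((A ^\<^sub>m k) $$ (i, j) - e)\<^sup>2) * (\<Sum>j<n. (x j)\<^sup>2))"
      unfolding a_def vk by (intro sum_mono Cauchy_Schwarz_ineq_sum)
    also have "\<dots> = (\<Sum>i<n. \<Sum>j<n. ((A ^\<^sub>m k) $$ (i, j) - e)\<^sup>2) * (\<Sum>j<n. (x j)\<^sup>2)"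
      by (simp add: sum_distrib_right)
    finally have ak: "a k \<le> (\<Sum>i<n. \<Sum>j<n. ((A ^\<^sub>m k) $$ (i, j) - e)\<^sup>2) * (\<Sum>j<n. (x j)\<^sup>2)" .
    have "(\<Sum>i<n. \<Sum>j<n. ((A ^\<^sub>m k) $$ (i, j) - e)\<^sup>2)
       = (\<Sum>i<n. (\<Sum>j<n. ((A ^\<^sub>m k) $$ (i, j))\<^sup>2) - 2 * e * d ^ k + n * e\<^sup>2)"
      using rowk by (intro sum.cong refl) 
       (auto simp: power2_diff sum.distrib sum_subtractf mult_ac simp flip: sum_distrib_left)
    also have "\<dots> = (\<Sum>i<n. (\<mu> ! i) ^ (2 * k)) - d ^ (2 * k)"
    proof -
      have ne: "n * e = d ^ k" using n by (simp add: e_def)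
      have "n * (2 * e * d ^ k - n * e\<^sup>2) = 2 * (n * e) * d ^ k - (n * e) * (n * e)"
        by (simp only: algebra_simps power2_eq_square)
      also have "\<dots> = d ^ (2 * k)" unfolding ne mult_2 power_add by simp
      finally have *: "n * (2 * e * d ^ k - n * e\<^sup>2) = d ^ (2 * k)" .
      have "(\<Sum>i<n. (\<Sum>j<n. ((A ^\<^sub>m k) $$ (i, j))\<^sup>2) - 2 * e * d ^ k + n * e\<^sup>2)
        = (\<Sum>i<n. (\<Sum>j<n. ((A ^\<^sub>m k) $$ (i, j))\<^sup>2) - (2 * e * d ^ k - n * e\<^sup>2))"
        by (intro sum.cong) auto
      also have "\<dots> = (\<Sum>i<n. (\<mu> ! i) ^ (2 * k)) - n * (2 * e * d ^ k - n * e\<^sup>2)"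
        unfolding sum_subtractf[of _ "\<lambda>_. 2 * e * d ^ k - n * e\<^sup>2"] trk by (simp del: right_diff_distrib left_diff_distrib)
      finally show ?thesis unfolding * .
    qed
    also have "\<dots> = (\<Sum>i=1..<n. (\<mu> ! i) ^ (2 * k))"
      using n top by (simp add: lessThan_atLeast0 sum.atLeast_Suc_lessThan)
    also have "\<dots> \<le> (\<Sum>i=1..<n. (l\<^sup>2) ^ k)"
    proof (intro sum_mono)
      fix i assume "i \<in> {1..<n}"
      then have "(\<mu> ! i)\<^sup>2 \<le> l\<^sup>2" using small[of i] by (simp add: abs_le_square_iff[symmetric])
      then show "(\<mu> ! i) ^ (2 * k) \<le> (l\<^sup>2) ^ k" by (simp add: power_mult power_mono)
    qed
    also have "\<dots> \<le> n * (l\<^sup>2) ^ k" by (simp add: mult_right_mono)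
    finally show ?thesis
      using ak mult_right_mono[of _ "n * (l\<^sup>2) ^ k" "\<Sum>j<n. (x j)\<^sup>2"]
      by (fastforce simp: mult_ac sum_nonneg)
  qed
  have "a 1 \<le> l\<^sup>2 * a 0"
    by (rule log_convex_growth_bound[of a, OF _ convex bound]) (auto simp: a_def sum_nonneg)
  moreover have "a 0 = (\<Sum>i<n. (x i)\<^sup>2)" unfolding a_def by (intro sum.cong refl) (simp add: v0)
  moreover have "a 1 = (\<Sum>i<n. (\<Sum>j<n. A $$ (i, j) * x j)\<^sup>2)"
    unfolding a_def by (intro sum.cong refl) (simp add: vSuc v0)
  ultimately show ?thesis by simp
qed

section \<open>From adjacency matrices to edge counts between vertex sets\<close>

lemma regular_graph_row_sum:
  assumes "regular_graph n d E" "i < n"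
  shows "(\<Sum>j<n. adjacency_matrix n E $$ (i, j)) = real d"
proof -
  have sub: "E \<subseteq> nsets {..<n} 2" and deg: "card {e \<in> E. i \<in> e} = d"
    using assms by (auto simp: regular_graph_def graph_on_def)
  have "bij_betw (\<lambda>j. {i, j}) {j. j < n \<and> {i, j} \<in> E} {e \<in> E. i \<in> e}"
  proof (rule bij_betw_imageI)
    show "inj_on (\<lambda>j. {i, j}) {j. j < n \<and> {i, j} \<in> E}"
      by (auto simp: inj_on_def doubleton_eq_iff)
    show "(\<lambda>j. {i, j}) ` {j. j < n \<and> {i, j} \<in> E} = {e \<in> E. i \<in> e}"
    proof (intro equalityI subsetI)
      fix e assume e: "e \<in> {e \<in> E. i \<in> e}"
      then have "e \<in> nsets {..<n} 2" using sub by auto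
      then obtain x y where "e = {x, y}" "x < n" "y < n" by (auto elim: nsets2_E)
      with e show "e \<in> (\<lambda>j. {i, j}) ` {j. j < n \<and> {i, j} \<in> E}"
        by (auto simp: insert_commute)
    qed auto
  qed
  then have "card {j. j < n \<and> {i, j} \<in> E} = d" using deg by (simp add: bij_betw_same_card)
  moreover have "(\<Sum>j<n. adjacency_matrix n E $$ (i, j)) = (\<Sum>j<n. if {i, j} \<in> E then 1 else 0)"
    using assms(2) by (intro sum.cong) (auto simp: adjacency_matrix_def)
  moreover have "\<dots> = real (card {j. j < n \<and> {i, j} \<in> E})"
    by (simp add: sum.If_cases Int_def)
  ultimately show ?thesis by simp
qed

text \<open>Apply the contraction to the indicator of \<open>B\<close> minus its mean: entry
  \<open>i\<close> of the image is the number of neighbours of \<open>i\<close> in \<open>B\<close>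
  minus the expected \<open>d * card B / n\<close>. Cauchy-Schwarz over \<open>X\<close> finishes.
  The absolute value covers \<open>n = 1\<close>, where nothing forces \<open>l\<close> to be
  nonnegative.\<close>

lemma expander_mixing_lower:
  assumes G: "ndl_graph n d l E" and n: "n \<ge> 1" and X: "X \<subseteq> {..<n}" and B: "B \<subseteq> {..<n}"
  shows "real d * card X * card B / n - \<bar>l\<bar> * sqrt (real (card X) * real (card B))
         \<le> (\<Sum>v\<in>X. real (card {w \<in> B. {v, w} \<in> E}))"
proof -
  define A where "A = adjacency_matrix n E"
  obtain \<mu> where \<mu>: "adjacency_spectrum n E \<mu>" "\<mu> ! 0 = real d" "\<forall>j\<in>{1..<n}. \<bar>\<mu> ! j\<bar> \<le> l"
    and reg: "regular_graph n d E" using G by (auto simp: ndl_graph_def)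
  have A: "A \<in> carrier_mat n n" and entry: "\<And>i j. i < n \<Longrightarrow> j < n \<Longrightarrow> A $$ (i, j) = (if {i, j} \<in> E then 1 else 0)"
    by (auto simp: A_def adjacency_matrix_def)
  have fin: "finite X" "finite B" using X B finite_subset by auto
  define b where "b = real (card B) / n"
  define x where "x j = indicator B j - b" for j
  have indB: "(\<Sum>j<n. f j * indicator B j) = (\<Sum>j\<in>B. f j :: real)" for f
    using B by (simp add: sum.inter_restrict[symmetric] indicator_def if_distrib Int_absorb1 cong: if_cong)
  have x0: "(\<Sum>j<n. x j) = 0" using indB[of "\<lambda>_. 1"] n by (simp add: x_def sum_subtractf b_def)
  have norm: "(\<Sum>j<n. (x j)\<^sup>2) \<le> card B"
  proof -
    have "(\<Sum>j<n. (x j)\<^sup>2) = (\<Sum>j<n. x j * indicator B j) - b * (\<Sum>j<n. x j)"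
      unfolding sum_distrib_left by (simp add: x_def power2_eq_square algebra_simps flip: sum_subtractf)
    also have "\<dots> = (\<Sum>j\<in>B. x j)" using x0 indB by simp
    also have "\<dots> \<le> (\<Sum>j\<in>B. 1)" by (intro sum_mono) (auto simp: x_def b_def)
    finally show ?thesis by simp
  qed
  define y where "y i = (\<Sum>j<n. A $$ (i, j) * x j)" for i
  have y: "y i = real (card {w \<in> B. {i, w} \<in> E}) - b * d" if "i < n" for i
  proof -
    have "y i = (\<Sum>j<n. A $$ (i, j) * indicator B j) - b * (\<Sum>j<n. A $$ (i, j))"
      unfolding y_def x_def by (simp add: algebra_simps sum_subtractf sum_distrib_left)
    also have "(\<Sum>j<n. A $$ (i, j) * indicator B j) = (\<Sum>j\<in>B. if {i, j} \<in> E then 1 else 0)"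
      unfolding indB using B that by (intro sum.cong) (auto simp: entry)
    also have "\<dots> = real (card {w \<in> B. {i, w} \<in> E})" using fin by (simp add: sum.If_cases Int_def)
    also have "(\<Sum>j<n. A $$ (i, j)) = d" using regular_graph_row_sum[OF reg that] by (simp add: A_def)
    finally show ?thesis .
  qed
  have "(\<Sum>i<n. (y i)\<^sup>2) \<le> l\<^sup>2 * (\<Sum>i<n. (x i)\<^sup>2)"
    unfolding y_def
  proof (rule contraction_on_constants_complement[OF A _ _ _ _ \<mu>(2) _ n x0])
    show "char_poly A = (\<Prod>y\<leftarrow>\<mu>. [:- y, 1:])" "length \<mu> = n"
      using \<mu>(1) by (auto simp: adjacency_spectrum_def A_def)
    show "(\<Sum>j<n. A $$ (i, j)) = real d" if "i < n" for i
      using regular_graph_row_sum[OF reg that] by (simp add: A_def)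
  qed (use \<mu> in \<open>auto simp: entry insert_commute\<close>)
  also have "\<dots> \<le> l\<^sup>2 * card B" using norm by (intro mult_left_mono) auto
  finally have yy: "(\<Sum>i<n. (y i)\<^sup>2) \<le> l\<^sup>2 * card B" .
  have "(\<Sum>v\<in>X. 1 * y v)\<^sup>2 \<le> (\<Sum>v\<in>X. 1\<^sup>2) * (\<Sum>v\<in>X. (y v)\<^sup>2)" by (rule Cauchy_Schwarz_ineq_sum)
  also have "\<dots> \<le> card X * (\<Sum>i<n. (y i)\<^sup>2)"
    using X by (auto intro!: mult_left_mono sum_mono2)
  also have "\<dots> \<le> card X * (l\<^sup>2 * card B)" using yy by (rule mult_left_mono) auto
  finally have "\<bar>\<Sum>v\<in>X. y v\<bar> \<le> sqrt (card X * (l\<^sup>2 * card B))"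
    by (intro real_le_rsqrt) auto
  also have "\<dots> = \<bar>l\<bar> * sqrt (real (card X) * real (card B))"
    by (simp add: real_sqrt_mult)
  finally have "- (\<bar>l\<bar> * sqrt (real (card X) * real (card B))) \<le> (\<Sum>v\<in>X. y v)" by linarith
  also have "(\<Sum>v\<in>X. y v) = (\<Sum>v\<in>X. real (card {w \<in> B. {v, w} \<in> E}) - b * d)"
    using X by (intro sum.cong refl y) auto
  also have "\<dots> = (\<Sum>v\<in>X. real (card {w \<in> B. {v, w} \<in> E})) - real d * card X * card B / n"
    by (simp add: sum_subtractf b_def)
  finally show ?thesis by linarith
qed

section \<open>The hard-core model and locally sparse graphs\<close>

definition independent_set :: "('a \<Rightarrow> 'a \<Rightarrow> bool) \<Rightarrow> 'a set \<Rightarrow> bool" where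
  "independent_set adj W \<longleftrightarrow> (\<forall>u\<in>W. \<forall>v\<in>W. \<not> adj u v)"

definition independent_subsets :: "('a \<Rightarrow> 'a \<Rightarrow> bool) \<Rightarrow> 'a set \<Rightarrow> 'a set set" where
  "independent_subsets adj X = {U. U \<subseteq> X \<and> independent_set adj U}"

text \<open>The independence polynomial at \<open>q\<close>, the normalizing constant of the
  hard-core measure. Expectations under this measure are kept below as weighted sums compared with
  multiples of it.\<close>

definition partition_function :: "('a \<Rightarrow> 'a \<Rightarrow> bool) \<Rightarrow> real \<Rightarrow> 'a set \<Rightarrow> real" where
  "partition_function adj q X = (\<Sum>U\<in>independent_subsets adj X. q ^ card U)"

lemma finite_independent_subsets [simp, intro]: "finite X \<Longrightarrow> finite (independent_subsets adj X)"
  by (rule finite_subset[of _ "Pow X"]) (auto simp: independent_subsets_def)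

lemma empty_in_independent_subsets [simp]: "{} \<in> independent_subsets adj X"
  by (simp add: independent_subsets_def independent_set_def)

lemma sum_Pow_power_card:
  fixes q :: "'b :: comm_semiring_1"
  assumes "finite X"
  shows "(\<Sum>U\<in>Pow X. q ^ card U) = (1 + q) ^ card X"
  using prod_add[OF assms, of "\<lambda>_. q" "\<lambda>_. 1"] by (simp add: add.commute)

lemma partition_function_le:
  assumes "finite X" "0 \<le> q"
  shows "partition_function adj q X \<le> (1 + q) ^ card X"
  unfolding partition_function_def sum_Pow_power_card[OF assms(1), symmetric]
  using assms by (intro sum_mono2) (auto simp: independent_subsets_def)

lemma partition_function_ge_1:
  assumes "finite X" "0 \<le> q"
  shows "1 \<le> partition_function adj q X"
proof -
  have "(\<Sum>U\<in>{{}}. q ^ card (U :: 'a set)) \<le> partition_function adj q X"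
    unfolding partition_function_def using assms by (intro sum_mono2) auto
  then show ?thesis by simp
qed

text \<open>Split each independent set into its parts inside and outside \<open>N\<close> and forget
  independence inside.\<close>

lemma partition_function_submultiplicative:
  assumes fin: "finite X" and q: "0 \<le> q"
  shows "partition_function adj q X \<le> (1 + q) ^ card (X \<inter> N) * partition_function adj q (X - N)"
proof -
  let ?I = "independent_subsets adj"
  let ?h = "\<lambda>U. (U \<inter> N, U - N)"
  have inj: "inj_on ?h (?I X)" by (auto simp: inj_on_def)
  have "partition_function adj q X = (\<Sum>U\<in>?I X. q ^ card (U \<inter> N) * q ^ card (U - N))"
    unfolding partition_function_def
  proof (intro sum.cong refl)
    fix U assume "U \<in> ?I X"
    then have "finite U" using fin finite_subset by (auto simp: independent_subsets_def)
    then have "card U = card (U \<inter> N) + card (U - N)" by (simp add: card_Int_Diff)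
    then show "q ^ card U = q ^ card (U \<inter> N) * q ^ card (U - N)" by (simp add: power_add)
  qed
  also have "\<dots> = (\<Sum>(U1, U2)\<in>?h ` ?I X. q ^ card U1 * q ^ card U2)"
    by (subst sum.reindex[OF inj]) simp
  also have "\<dots> \<le> (\<Sum>(U1, U2)\<in>Pow (X \<inter> N) \<times> ?I (X - N). q ^ card U1 * q ^ card U2)"
  proof (rule sum_mono2)
    show "?h ` ?I X \<subseteq> Pow (X \<inter> N) \<times> ?I (X - N)"
      by (auto simp: independent_subsets_def independent_set_def)
  qed (use fin q in auto)
  also have "\<dots> = (\<Sum>U\<in>Pow (X \<inter> N). q ^ card U) * partition_function adj q (X - N)"
    unfolding partition_function_def sum_product sum.cartesian_product by simp
  finally show ?thesis using fin by (subst (asm) sum_Pow_power_card) auto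
qed

lemma sum_card_eq:
  fixes w :: "'a set \<Rightarrow> real"
  assumes "finite F" "finite X" "\<And>U. U \<in> F \<Longrightarrow> U \<subseteq> X"
  shows "(\<Sum>U\<in>F. w U * card U) = (\<Sum>u\<in>X. \<Sum>U\<in>{U \<in> F. u \<in> U}. w U)"
proof -
  have "(\<Sum>U\<in>F. w U * card U) = (\<Sum>U\<in>F. \<Sum>u\<in>X. if u \<in> U then w U else 0)"
  proof (intro sum.cong refl)
    fix U assume "U \<in> F"
    then have "X \<inter> {u. u \<in> U} = U" using assms(3) by auto
    then show "w U * card U = (\<Sum>u\<in>X. if u \<in> U then w U else 0)"
      using assms(2) by (simp add: sum.If_cases)
  qed
  also have "\<dots> = (\<Sum>u\<in>X. \<Sum>U\<in>F. if u \<in> U then w U else 0)" by (rule sum.swap)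
  also have "\<dots> = (\<Sum>u\<in>X. \<Sum>U\<in>{U \<in> F. u \<in> U}. w U)"
    using assms(1) by (simp add: sum.If_cases Int_def)
  finally show ?thesis .
qed

lemma sum_containing_vertex:
  assumes sym: "\<And>a b. adj a b \<Longrightarrow> adj b a" and irr: "\<And>a. \<not> adj a a"
    and fin: "finite X" and u: "u \<in> X"
  shows "(\<Sum>U\<in>{U \<in> independent_subsets adj X. u \<in> U}. q ^ card U)
    = q * partition_function adj q (X - insert u {w \<in> X. adj u w})"
proof -
  let ?Y = "X - insert u {w \<in> X. adj u w}"
  have inj: "inj_on (insert u) (independent_subsets adj ?Y)"
    by (auto simp: inj_on_def independent_subsets_def)
  have eq: "{U \<in> independent_subsets adj X. u \<in> U} = insert u ` independent_subsets adj ?Y"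
  proof (intro equalityI subsetI)
    fix U assume U: "U \<in> {U \<in> independent_subsets adj X. u \<in> U}"
    then have "U - {u} \<in> independent_subsets adj ?Y"
      by (auto simp: independent_subsets_def independent_set_def)
    moreover have "U = insert u (U - {u})" using U by auto
    ultimately show "U \<in> insert u ` independent_subsets adj ?Y" by blast
  next
    fix U assume "U \<in> insert u ` independent_subsets adj ?Y"
    then show "U \<in> {U \<in> independent_subsets adj X. u \<in> U}"
      using u sym irr by (fastforce simp: independent_subsets_def independent_set_def)
  qed
  have "(\<Sum>U\<in>{U \<in> independent_subsets adj X. u \<in> U}. q ^ card U)
     = (\<Sum>U\<in>independent_subsets adj ?Y. q ^ card (insert u U))"
    unfolding eq by (subst sum.reindex[OF inj]) simp
  also have "\<dots> = (\<Sum>U\<in>independent_subsets adj ?Y. q * q ^ card U)"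
  proof (intro sum.cong refl)
    fix U assume U: "U \<in> independent_subsets adj ?Y"
    then have "finite U" "u \<notin> U" using fin finite_subset[of U X] by (auto simp: independent_subsets_def)
    then show "q ^ card (insert u U) = q * q ^ card U" by simp
  qed
  finally show ?thesis by (simp add: partition_function_def sum_distrib_left)
qed

text \<open>A vertex \<open>u\<close> is occupied with probability \<open>q\<close> times the ratio
  of the partition functions without and with its closed neighbourhood, hence at least
  \<open>q * (1 - q * (1 + deg u))\<close>. This is linear in the degree, so a bound
  \<open>M\<close> on the average degree suffices. With \<open>q * M = 1/4\<close> and
  \<open>q \<le> 1/4\<close>, at least half of \<open>q * card X\<close> survives.\<close>

lemma expected_size_lower_bound:
  fixes M :: real
  assumes sym: "\<And>a b. adj a b \<Longrightarrow> adj b a" and irr: "\<And>a. \<not> adj a a"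
    and fin: "finite X" and M: "M \<ge> 1" and sparse: "(\<Sum>u\<in>X. real (card {w \<in> X. adj u w})) \<le> M * card X"
  defines "q \<equiv> 1 / (4 * M)"
  shows "q * card X / 2 * partition_function adj q X
    \<le> (\<Sum>U\<in>independent_subsets adj X. q ^ card U * card U)"
proof -
  let ?Z = "partition_function adj q"
  have q: "q > 0" "q * M = 1 / 4" "q \<le> 1 / 4" using M by (auto simp: q_def field_simps)
  have Z: "?Z X \<ge> 0" using partition_function_ge_1[OF fin, of q adj] q by simp
  have "q * (1 - q * (1 + card {w \<in> X. adj u w})) * ?Z X
      \<le> (\<Sum>U\<in>{U \<in> independent_subsets adj X. u \<in> U}. q ^ card U)" if u: "u \<in> X" for u
  proof -
    let ?N = "insert u {w \<in> X. adj u w}"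
    have card: "card (X \<inter> ?N) = 1 + card {w \<in> X. adj u w}"
      using fin u irr by (subst Int_absorb1) auto
    define p where "p = (1 + q) ^ card (X \<inter> ?N)"
    have p: "p > 0" using q by (simp add: p_def)
    have "p \<le> exp (q * card (X \<inter> ?N))"
      unfolding p_def exp_of_nat2_mult using exp_ge_add_one_self[of q] q by (intro power_mono) auto
    then have "exp (- (q * card (X \<inter> ?N))) * p \<le> 1"
      by (simp add: exp_minus field_simps)
    moreover have "1 - q * card (X \<inter> ?N) \<le> exp (- (q * card (X \<inter> ?N)))"
      using exp_ge_add_one_self[of "- (q * card (X \<inter> ?N))"] by simp
    ultimately have le1: "(1 - q * card (X \<inter> ?N)) * p \<le> 1"
      using p by (meson mult_right_mono order_trans less_imp_le)
    have "(1 - q * card (X \<inter> ?N)) * ?Z X \<le> ?Z (X - ?N)"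
    proof (cases "1 - q * card (X \<inter> ?N) \<ge> 0")
      case True
      have "(1 - q * card (X \<inter> ?N)) * ?Z X \<le> (1 - q * card (X \<inter> ?N)) * (p * ?Z (X - ?N))"
        using partition_function_submultiplicative[OF fin, of q adj ?N] q True
        by (intro mult_left_mono) (auto simp: p_def)
      also have "\<dots> = ((1 - q * card (X \<inter> ?N)) * p) * ?Z (X - ?N)" by simp
      also have "\<dots> \<le> 1 * ?Z (X - ?N)"
        using le1 partition_function_ge_1[of "X - ?N" q adj] fin q by (intro mult_right_mono) auto
      finally show ?thesis by simp
    next
      case False
      then have "(1 - q * card (X \<inter> ?N)) * ?Z X \<le> 0" using Z by (simp add: mult_nonpos_nonneg)
      then show ?thesis using partition_function_ge_1[of "X - ?N" q adj] fin q by simp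
    qed
    then have "q * ((1 - q * card (X \<inter> ?N)) * ?Z X) \<le> q * ?Z (X - ?N)" using q by simp
    moreover have "(\<Sum>U\<in>{U \<in> independent_subsets adj X. u \<in> U}. q ^ card U) = q * ?Z (X - ?N)"
      by (rule sum_containing_vertex[OF sym irr fin u])
    ultimately have "q * (1 - q * card (X \<inter> ?N)) * ?Z X \<le> (\<Sum>U\<in>{U \<in> independent_subsets adj X. u \<in> U}. q ^ card U)"
      by (simp only: mult.assoc)
    then show ?thesis unfolding card of_nat_add of_nat_1 .
  qed
  then have "(\<Sum>u\<in>X. q * (1 - q * (1 + card {w \<in> X. adj u w})) * ?Z X)
      \<le> (\<Sum>u\<in>X. \<Sum>U\<in>{U \<in> independent_subsets adj X. u \<in> U}. q ^ card U)"
    by (intro sum_mono)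
  also have "\<dots> = (\<Sum>U\<in>independent_subsets adj X. q ^ card U * card U)"
    using fin by (intro sum_card_eq[symmetric]) (auto simp: independent_subsets_def)
  also have "(\<Sum>u\<in>X. q * (1 - q * (1 + card {w \<in> X. adj u w})) * ?Z X)
    = q * (card X - q * card X - q * (\<Sum>u\<in>X. real (card {w \<in> X. adj u w}))) * ?Z X"
  proof -
    have "(\<Sum>u\<in>X. q * (1 - q * (1 + card {w \<in> X. adj u w})) * ?Z X)
      = (\<Sum>u\<in>X. q * (1 - q) * ?Z X - q * q * ?Z X * real (card {w \<in> X. adj u w}))"
      by (intro sum.cong refl) (simp add: algebra_simps)
    also have "\<dots> = card X * (q * (1 - q) * ?Z X) - q * q * ?Z X * (\<Sum>u\<in>X. real (card {w \<in> X. adj u w}))"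
      unfolding sum_subtractf sum_distrib_left[of "q * q * ?Z X"] by simp
    finally show ?thesis by (simp only: algebra_simps)
  qed
  finally have *: "q * (card X - q * card X - q * (\<Sum>u\<in>X. real (card {w \<in> X. adj u w}))) * ?Z X
     \<le> (\<Sum>U\<in>independent_subsets adj X. q ^ card U * card U)" .
  have "q * (\<Sum>u\<in>X. real (card {w \<in> X. adj u w})) \<le> q * (M * card X)"
    using sparse q by (intro mult_left_mono) auto
  also have "\<dots> = (q * M) * card X" by simp
  also have "\<dots> = card X / 4" unfolding q by simp
  finally have "card X / 2 \<le> card X - q * card X - q * (\<Sum>u\<in>X. real (card {w \<in> X. adj u w}))"
    using mult_right_mono[OF q(3), of "real (card X)"] by linarith
  then have "q * (card X / 2) * ?Z X \<le> q * (card X - q * card X - q * (\<Sum>u\<in>X. real (card {w \<in> X. adj u w}))) * ?Z X"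
    using q Z by (intro mult_right_mono mult_left_mono) auto
  with * show ?thesis by simp
qed

text \<open>With \<open>L = ln (D * q)\<close>, either \<open>q * x \<ge> L / 2\<close> and the
  expected size \<open>T\<close> alone reaches \<open>L / 4 * Z\<close>, or
  \<open>Z \<le> exp (L / 2)\<close> and \<open>D * q = exp L\<close> pays for it. Replacing
  \<open>q + Z\<close> by \<open>2 * Z\<close> turns the 4 into 8.\<close>

lemma fiber_inequality:
  fixes D q x Z T :: real
  assumes Dq: "D * q \<ge> 1" and q: "0 < q" "q \<le> 1" and x: "0 \<le> x"
    and Z: "1 \<le> Z" "Z \<le> exp (q * x)" and T: "q * x / 2 * Z \<le> T"
  shows "ln (D * q) / 8 * (q + Z) \<le> D * q + T"
proof -
  define L where "L = ln (D * q)"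
  have L: "L \<ge> 0" using Dq by (simp add: L_def)
  have "L / 8 * (q + Z) \<le> L / 8 * (2 * Z)" using L q Z by (intro mult_left_mono) auto
  also have "\<dots> = L / 4 * Z" by simp
  also have "\<dots> \<le> D * q + T"
  proof (cases "q * x \<ge> L / 2")
    case True
    have "L / 4 * Z \<le> q * x / 2 * Z" using True Z by (intro mult_right_mono) auto
    then show ?thesis using T Dq by linarith
  next
    case False
    have "0 \<le> T" using T q x Z by (smt (verit) mult_nonneg_nonneg divide_nonneg_nonneg)
    have "L / 4 \<le> exp (L / 2)" using exp_ge_add_one_self[of "L / 2"] L by linarith
    then have "L / 4 * Z \<le> exp (L / 2) * exp (L / 2)"
      using Z L False by (intro mult_mono order_trans[OF Z(2)]) auto
    also have "\<dots> = D * q" using Dq by (simp add: L_def flip: exp_add)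
    finally show ?thesis using \<open>0 \<le> T\<close> by simp
  qed
  finally show ?thesis by (simp add: L_def)
qed

text \<open>Conditioning on the trace \<open>H\<close> of the independent set outside the closed neighbourhood of
  \<open>v\<close>, the rest is either \<open>{v}\<close> or an independent subset of the set \<open>X\<close> of neighbours of \<open>v\<close> that
  are not adjacent to \<open>H\<close>.\<close>
lemma conditional_fiber:
  assumes sym: "\<And>a b. adj a b \<Longrightarrow> adj b a" and irr: "\<And>a. \<not> adj a a" and v: "v \<in> V"
    and W0: "W0 \<in> independent_subsets adj V"
  defines "N \<equiv> {u \<in> V. adj v u}"
  defines "H \<equiv> W0 - insert v N"
  defines "X \<equiv> {u \<in> N. \<forall>h\<in>H. \<not> adj u h}"
  shows "{W \<in> independent_subsets adj V. W - insert v N = H} = (\<union>) H ` insert {v} (independent_subsets adj X)"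
proof (intro equalityI subsetI)
  fix W assume "W \<in> {W \<in> independent_subsets adj V. W - insert v N = H}"
  then have W: "W \<subseteq> V" "\<And>a b. a \<in> W \<Longrightarrow> b \<in> W \<Longrightarrow> \<not> adj a b" "W - insert v N = H"
    by (auto simp: independent_subsets_def independent_set_def)
  show "W \<in> (\<union>) H ` insert {v} (independent_subsets adj X)"
  proof (cases "v \<in> W")
    case True
    then have "W = H \<union> {v}" using W by (auto simp: N_def)
    then show ?thesis by blast
  next
    case False
    then have "W = H \<union> (W \<inter> N)" using W(3) by auto
    moreover have "W \<inter> N \<in> independent_subsets adj X"
      using W by (auto simp: independent_subsets_def independent_set_def X_def)
    ultimately show ?thesis by blast
  qed
next
  have H: "H \<subseteq> V" "\<And>a b. a \<in> H \<Longrightarrow> b \<in> H \<Longrightarrow> \<not> adj a b" "H \<inter> insert v N = {}"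
    using W0 by (auto simp: independent_subsets_def independent_set_def H_def)
  fix W assume "W \<in> (\<union>) H ` insert {v} (independent_subsets adj X)"
  then obtain U where U: "W = H \<union> U" "U = {v} \<or> U \<in> independent_subsets adj X" by blast
  have "U \<subseteq> insert v N" "U \<subseteq> V" using U(2) v by (auto simp: independent_subsets_def X_def N_def)
  moreover have "\<not> adj a b" "\<not> adj b a" if "a \<in> U" "b \<in> H" for a b
    using that U(2) H sym unfolding independent_subsets_def X_def N_def by blast+
  moreover have "\<not> adj a b" if "a \<in> U" "b \<in> U" for a b
    using that U(2) irr by (auto simp: independent_subsets_def independent_set_def)
  ultimately show "W \<in> {W \<in> independent_subsets adj V. W - insert v N = H}"
    using H U(1) by (auto simp: independent_subsets_def independent_set_def)
qed

text \<open>Divided by the partition function, this bounds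
  \<open>D * P(v \<in> W) + E(card (N \<inter> W))\<close> from below. It holds already on each
  fibre described in \<open>conditional_fiber\<close>, where it becomes
  \<open>fiber_inequality\<close>. Sparsity is assumed for every \<open>X\<close> inside the
  neighbourhood because the available set \<open>X\<close> depends on the fibre.\<close>

lemma local_occupancy:
  fixes M D :: real
  assumes sym: "\<And>a b. adj a b \<Longrightarrow> adj b a" and irr: "\<And>a. \<not> adj a a"
    and fin: "finite V" and v: "v \<in> V" and M: "M \<ge> 1" and DM: "D \<ge> 4 * M"
    and sparse: "\<And>X. X \<subseteq> {u \<in> V. adj v u} \<Longrightarrow> (\<Sum>u\<in>X. real (card {w \<in> X. adj u w})) \<le> M * card X"
  defines "q \<equiv> 1 / (4 * M)"
  shows "ln (D * q) / 8 * partition_function adj q V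
    \<le> (\<Sum>W\<in>independent_subsets adj V. q ^ card W * (D * indicator W v + card ({u \<in> V. adj v u} \<inter> W)))"
proof -
  let ?I = "independent_subsets adj"
  define N where "N = {u \<in> V. adj v u}"
  define g where "g W = W - insert v N" for W
  define w where "w W = q ^ card W * (D * indicator W v + card (N \<inter> W))" for W
  have q: "0 < q" "q \<le> 1" "D * q \<ge> 1" using M DM by (auto simp: q_def field_simps)
  have finI: "finite (?I V)" and finN: "finite N" and vN: "v \<notin> N" using fin irr by (auto simp: N_def)
  have fiber: "ln (D * q) / 8 * (\<Sum>W\<in>{W \<in> ?I V. g W = H}. q ^ card W) \<le> (\<Sum>W\<in>{W \<in> ?I V. g W = H}. w W)"
    if "H \<in> g ` ?I V" for H
  proof -
    from that obtain W0 where W0: "W0 \<in> ?I V" and H: "H = g W0" by auto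
    define X where "X = {u \<in> N. \<forall>h\<in>H. \<not> adj u h}"
    have XN: "X \<subseteq> N" and finX: "finite X" using finN by (auto simp: X_def)
    have HC: "H \<inter> insert v N = {}" and finH: "finite H"
      using W0 fin finite_subset[of W0 V] by (auto simp: H g_def independent_subsets_def)
    have eq: "{W \<in> ?I V. g W = H} = (\<union>) H ` insert {v} (?I X)"
      unfolding g_def H X_def N_def by (rule conditional_fiber[OF sym irr v W0])
    have U: "finite U \<and> U \<inter> H = {} \<and> U \<subseteq> insert v N" if "U \<in> insert {v} (?I X)" for U
      using that XN HC finX finite_subset[of U X] by (auto simp: independent_subsets_def)
    have inj: "inj_on ((\<union>) H) (insert {v} (?I X))"
      using U unfolding inj_on_def by blast
    have cardHU: "card (H \<union> U) = card H + card U" if "U \<in> insert {v} (?I X)" for U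
      using U[OF that] finH by (intro card_Un_disjoint) auto
    have new: "{v} \<notin> ?I X" using vN XN by (auto simp: independent_subsets_def)
    have "(\<Sum>W\<in>{W \<in> ?I V. g W = H}. q ^ card W) = (\<Sum>U\<in>insert {v} (?I X). q ^ card H * q ^ card U)"
      unfolding eq sum.reindex[OF inj] by (intro sum.cong) (auto simp: cardHU power_add)
    also have "\<dots> = q ^ card H * (q + partition_function adj q X)"
      using new finX by (simp add: partition_function_def sum_distrib_left distrib_left)
    finally have 1: "(\<Sum>W\<in>{W \<in> ?I V. g W = H}. q ^ card W) = q ^ card H * (q + partition_function adj q X)" .
    have wHU: "w (H \<union> U) = q ^ card H * (q ^ card U * (D * indicator U v + card (N \<inter> U)))"
      if "U \<in> insert {v} (?I X)" for U
    proof -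
      have "N \<inter> (H \<union> U) = N \<inter> U" "v \<notin> H" using HC by auto
      then show ?thesis unfolding w_def cardHU[OF that] by (simp add: power_add indicator_def)
    qed
    have "(\<Sum>W\<in>{W \<in> ?I V. g W = H}. w W)
      = (\<Sum>U\<in>insert {v} (?I X). q ^ card H * (q ^ card U * (D * indicator U v + card (N \<inter> U))))"
      unfolding eq sum.reindex[OF inj] by (intro sum.cong) (auto simp: wHU)
    also have "\<dots> = q ^ card H * (\<Sum>U\<in>insert {v} (?I X). q ^ card U * (D * indicator U v + card (N \<inter> U)))"
      by (simp add: sum_distrib_left)
    also have "(\<Sum>U\<in>insert {v} (?I X). q ^ card U * (D * indicator U v + card (N \<inter> U)))
      = D * q + (\<Sum>U\<in>?I X. q ^ card U * (D * indicator U v + card (N \<inter> U)))"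
      using new finX vN by simp
    also have "(\<Sum>U\<in>?I X. q ^ card U * (D * indicator U v + card (N \<inter> U))) = (\<Sum>U\<in>?I X. q ^ card U * card U)"
    proof (intro sum.cong refl)
      fix U assume "U \<in> ?I X"
      then have "v \<notin> U" "N \<inter> U = U" using vN XN by (auto simp: independent_subsets_def)
      then show "q ^ card U * (D * indicator U v + card (N \<inter> U)) = q ^ card U * card U" by simp
    qed
    finally have 2: "(\<Sum>W\<in>{W \<in> ?I V. g W = H}. w W)
      = q ^ card H * (D * q + (\<Sum>U\<in>?I X. q ^ card U * card U))" .
    have "partition_function adj q X \<le> (1 + q) ^ card X"
      using partition_function_le[OF finX] q by simp
    also have "\<dots> \<le> exp q ^ card X" using exp_ge_add_one_self[of q] q by (intro power_mono) auto
    also have "\<dots> = exp (q * card X)" by (simp add: exp_of_nat2_mult)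
    finally have "ln (D * q) / 8 * (q + partition_function adj q X) \<le> D * q + (\<Sum>U\<in>?I X. q ^ card U * card U)"
      using q partition_function_ge_1[OF finX, of q adj]
        expected_size_lower_bound[OF sym irr finX M sparse[of X]] XN
      by (intro fiber_inequality[of _ _ "card X"]) (auto simp: N_def q_def)
    then have "q ^ card H * (ln (D * q) / 8 * (q + partition_function adj q X))
        \<le> q ^ card H * (D * q + (\<Sum>U\<in>?I X. q ^ card U * card U))"
      using q by (intro mult_left_mono) auto
    then show ?thesis unfolding 1 2 by (simp add: mult_ac)
  qed
  have "ln (D * q) / 8 * partition_function adj q V
    = ln (D * q) / 8 * (\<Sum>H\<in>g ` ?I V. \<Sum>W\<in>{W \<in> ?I V. g W = H}. q ^ card W)"
    unfolding partition_function_def using finI by (subst sum.group) auto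
  also have "\<dots> \<le> (\<Sum>H\<in>g ` ?I V. \<Sum>W\<in>{W \<in> ?I V. g W = H}. w W)"
    unfolding sum_distrib_left[of _ _ "g ` ?I V"] by (intro sum_mono fiber)
  also have "\<dots> = (\<Sum>W\<in>?I V. w W)" using finI by (intro sum.group) auto
  finally show ?thesis by (simp add: w_def N_def)
qed

text \<open>Sum the local occupancies over \<open>v\<close>. A fixed \<open>W\<close> receives
  \<open>D\<close> from each of its vertices and, by the degree bound, at most \<open>D\<close> more
  from that vertex being counted as a neighbour, so some \<open>W\<close> is as large as the average
  demands. The 16 is this 2 times the 8 of \<open>local_occupancy\<close>.\<close>

theorem independent_set_locally_sparse:
  fixes M D :: real
  assumes sym: "\<And>a b. adj a b \<Longrightarrow> adj b a" and irr: "\<And>a. \<not> adj a a"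
    and fin: "finite V" and M: "M \<ge> 1" and DM: "D \<ge> 4 * M"
    and deg: "\<And>v. v \<in> V \<Longrightarrow> card {u \<in> V. adj v u} \<le> D"
    and sparse: "\<And>v X. v \<in> V \<Longrightarrow> X \<subseteq> {u \<in> V. adj v u} \<Longrightarrow>
      (\<Sum>u\<in>X. real (card {w \<in> X. adj u w})) \<le> M * card X"
  obtains W where "W \<subseteq> V" "independent_set adj W" "card V * ln (D / (4 * M)) \<le> 16 * D * card W"
proof -
  let ?I = "independent_subsets adj V"
  define q where "q = 1 / (4 * M)"
  define L where "L = ln (D * q) / 8"
  define Z where "Z = partition_function adj q V"
  have q: "0 < q" using M by (simp add: q_def)
  have D: "D > 0" using M DM by simp
  have Z: "Z \<ge> 1" unfolding Z_def using partition_function_ge_1[OF fin] q by simp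
  have count: "(\<Sum>v\<in>V. D * indicator W v + card ({u \<in> V. adj v u} \<inter> W)) \<le> 2 * D * card W"
    if W: "W \<in> ?I" for W
  proof -
    have WV: "W \<subseteq> V" using W by (auto simp: independent_subsets_def)
    have finW: "finite W" using WV fin finite_subset by auto
    have "(\<Sum>v\<in>V. real (card ({u \<in> V. adj v u} \<inter> W))) = (\<Sum>v\<in>V. \<Sum>w\<in>W. if adj v w then 1 else 0)"
    proof (intro sum.cong refl)
      fix v
      have "{u \<in> V. adj v u} \<inter> W = W \<inter> {w. adj v w}" using WV by auto
      then show "real (card ({u \<in> V. adj v u} \<inter> W)) = (\<Sum>w\<in>W. if adj v w then 1 else 0)"
        using finW by (simp add: sum.If_cases)
    qed
    also have "\<dots> = (\<Sum>w\<in>W. \<Sum>v\<in>V. if adj v w then 1 else 0)" by (rule sum.swap)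
    also have "\<dots> = (\<Sum>w\<in>W. real (card {u \<in> V. adj w u}))"
    proof (intro sum.cong refl)
      fix w
      have "{u \<in> V. adj w u} = V \<inter> {v. adj v w}" using sym by auto
      then show "(\<Sum>v\<in>V. if adj v w then 1 else 0) = real (card {u \<in> V. adj w u})"
        using fin by (simp add: sum.If_cases)
    qed
    also have "\<dots> \<le> (\<Sum>w\<in>W. D)" using WV deg by (intro sum_mono) auto
    finally have 1: "(\<Sum>v\<in>V. real (card ({u \<in> V. adj v u} \<inter> W))) \<le> D * card W" by (simp add: mult.commute)
    have "(\<Sum>v\<in>V. indicator W v :: real) = card W"
      using WV fin by (simp add: indicator_def sum.If_cases Int_absorb1)
    then show ?thesis using 1 by (simp add: sum.distrib flip: sum_distrib_left)
  qed
  have "card V * (L * Z) = (\<Sum>v\<in>V. L * Z)" by simp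
  also have "\<dots> \<le> (\<Sum>v\<in>V. \<Sum>W\<in>?I. q ^ card W * (D * indicator W v + card ({u \<in> V. adj v u} \<inter> W)))"
    unfolding L_def Z_def q_def by (intro sum_mono local_occupancy[OF sym irr fin _ M DM sparse])
  also have "\<dots> = (\<Sum>W\<in>?I. q ^ card W * (\<Sum>v\<in>V. D * indicator W v + card ({u \<in> V. adj v u} \<inter> W)))"
    unfolding sum_distrib_left by (rule sum.swap)
  also have "\<dots> \<le> (\<Sum>W\<in>?I. q ^ card W * (2 * D * card W))"
    using q count by (intro sum_mono mult_left_mono) auto
  finally have le: "card V * (L * Z) \<le> (\<Sum>W\<in>?I. q ^ card W * (2 * D * card W))" .
  have "\<exists>W\<in>?I. card V * L \<le> 2 * D * card W"
  proof (rule ccontr)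
    assume "\<not> ?thesis"
    then have "(\<Sum>W\<in>?I. q ^ card W * (2 * D * card W)) < (\<Sum>W\<in>?I. q ^ card W * (card V * L))"
      using fin q by (intro sum_strict_mono) (auto simp: not_le intro: exI[of _ "{}"] empty_in_independent_subsets)
    also have "\<dots> = card V * (L * Z)"
      unfolding Z_def partition_function_def sum_distrib_left by (intro sum.cong) auto
    finally show False using le by simp
  qed
  then obtain W where W: "W \<in> ?I" "card V * L \<le> 2 * D * card W" by auto
  then have "card V * ln (D / (4 * M)) \<le> 16 * D * card W" by (simp add: L_def q_def)
  with W that show ?thesis by (auto simp: independent_subsets_def)
qed

section \<open>Upper bound\<close>

text \<open>An arbitrary finite \<open>V\<close> lets the notion pass to neighbourhoods without
  relabelling. The colour \<open>length s\<close> is the position of \<open>t\<close> in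
  \<open>s @ [t]\<close>.\<close>

definition avoids :: "(nat set \<Rightarrow> nat) \<Rightarrow> nat set \<Rightarrow> nat list \<Rightarrow> nat \<Rightarrow> bool" where
  "avoids f V s t \<longleftrightarrow> finite V \<and> f \<in> nsets V 2 \<rightarrow> {..length s} \<and>
     (\<forall>i<length s. \<not> monochromatic V (s ! i) 2 f i) \<and> \<not> monochromatic V t 2 f (length s)"

text \<open>The scale \<open>g\<close> is a parameter because twice restricted sets are measured
  against \<open>ramsey_scale S t * ln t / t\<close>, also when the reduced list lies outside the
  induction.\<close>

definition avoidance_bound :: "nat list \<Rightarrow> (nat \<Rightarrow> real) \<Rightarrow> real \<Rightarrow> bool" where
  "avoidance_bound s g C \<longleftrightarrow> (\<forall>\<^sub>F t in sequentially. \<forall>V f. avoids f V s t \<longrightarrow> real (card V) \<le> C * g t)"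

section \<open>Passing to colour neighbourhoods\<close>

lemma monochromatic_mono: "monochromatic W m 2 f i \<Longrightarrow> W \<subseteq> V \<Longrightarrow> monochromatic V m 2 f i"
  unfolding monochromatic_def using nsets_mono by blast

lemma monochromatic_insert:
  assumes mono: "monochromatic W m 2 f i" and v: "v \<notin> W" "\<And>w. w \<in> W \<Longrightarrow> f {v, w} = i"
  shows "monochromatic (insert v W) (Suc m) 2 f i"
proof -
  obtain H where H: "H \<in> nsets W m" "f ` nsets H 2 \<subseteq> {i}" using mono by (auto simp: monochromatic_def)
  then have "insert v H \<in> nsets (insert v W) (Suc m)"
    using v(1) by (auto simp: nsets_def card_insert_if)
  moreover have "f e = i" if eH: "e \<in> nsets (insert v H) 2" for e
  proof -
    obtain x y where e: "e = {x, y}" "x \<noteq> y" "x \<in> insert v H" "y \<in> insert v H"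
      using eH by (auto simp: nsets_2_eq)
    have HW: "H \<subseteq> W" using H(1) by (auto simp: nsets_def)
    show ?thesis
    proof (cases "x = v \<or> y = v")
      case True
      then obtain z where "z \<in> H" "e = {v, z}" using e by (auto simp: insert_commute)
      then show ?thesis using v(2) HW by auto
    next
      case False
      then have "e \<in> nsets H 2" using e by auto
      then show ?thesis using H(2) by auto
    qed
  qed
  ultimately show ?thesis unfolding monochromatic_def by blast
qed

text \<open>A set of at most one vertex contains no pair and is therefore monochromatic in every
  colour.\<close>

lemma avoids_small_entry:
  assumes "avoids f V s t" "i < length s" "s ! i \<le> 1"
  shows "V = {}"
proof (rule ccontr)
  assume "V \<noteq> {}"
  then obtain v where v: "v \<in> V" by auto
  have "{} \<in> nsets V 0" "{v} \<in> nsets V 1" "nsets {} 2 = ({} :: nat set set)" "nsets {v} 2 = {}"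
    using v by (auto simp: nsets_2_eq) (auto simp: nsets_def)
  then have "monochromatic V 0 2 f i" "monochromatic V 1 2 f i" unfolding monochromatic_def by blast+
  moreover have "s ! i = 0 \<or> s ! i = 1" using assms(3) by auto
  ultimately show False using assms(1,2) by (auto simp: avoids_def)
qed

lemma avoids_neighbourhood:
  assumes av: "avoids f V s t" and j: "j < length s" "s ! j \<ge> 1"
    and W: "W \<subseteq> V" and v: "v \<in> V" "v \<notin> W" "\<And>w. w \<in> W \<Longrightarrow> f {v, w} = j"
  shows "avoids f W (s[j := s ! j - 1]) t"
  unfolding avoids_def
proof (intro conjI allI impI)
  show "finite W" using av W finite_subset by (auto simp: avoids_def)
  show "f \<in> nsets W 2 \<rightarrow> {..length (s[j := s ! j - 1])}"
    using av nsets_mono[OF W, of 2] by (auto simp: avoids_def)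
  show "\<not> monochromatic W t 2 f (length (s[j := s ! j - 1]))"
    using av monochromatic_mono[OF _ W, of t f "length s"] by (auto simp: avoids_def)
  fix i assume i: "i < length (s[j := s ! j - 1])"
  show "\<not> monochromatic W (s[j := s ! j - 1] ! i) 2 f i"
  proof (cases "i = j")
    case True
    have "\<not> monochromatic V (Suc (s ! j - 1)) 2 f j" using av j by (simp add: avoids_def)
    then show ?thesis using monochromatic_insert[of W "s ! j - 1" f j v] v W True j
      by (auto dest: monochromatic_mono[of _ _ _ _ V])
  next
    case False
    then show ?thesis using av i monochromatic_mono[OF _ W, of "s ! i" f i] by (auto simp: avoids_def)
  qed
qed

text \<open>For \<open>j \<noteq> l\<close> the restrictions from \<open>v\<close> and from
  \<open>u\<close> concern different colours and apply to the same set side by side. For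
  \<open>j = l\<close> they must be nested: \<open>u\<close> itself has to lie in the
  \<open>j\<close>-neighbourhood of \<open>v\<close>, which is why \<open>f {u, v} = j\<close> is
  demanded there.\<close>

lemma avoids_codegree:
  assumes av: "avoids f V s t" and j: "j < length s" "s ! j \<ge> 2" and l: "l < length s" "s ! l \<ge> 2"
    and u: "u \<in> V" "v \<in> V" "u \<noteq> v" and jl: "j \<noteq> l \<or> f {u, v} = j"
  defines "s' \<equiv> s[j := s ! j - 1]"
  shows "avoids f {w \<in> V - {u, v}. f {v, w} = j \<and> f {u, w} = l} (s'[l := s' ! l - 1]) t"
    (is "avoids f ?Q _ t")
proof (cases "j = l")
  case False
  have 1: "avoids f ?Q s' t" unfolding s'_def
    using j by (intro avoids_neighbourhood[OF av _ _ _ u(2)]) auto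
  have 2: "avoids f ?Q (s[l := s ! l - 1]) t"
    using l by (intro avoids_neighbourhood[OF av _ _ _ u(1)]) auto
  have nth: "s' ! l = s ! l" using False by (simp add: s'_def)
  show ?thesis unfolding avoids_def
  proof (intro conjI allI impI)
    fix i assume i: "i < length (s'[l := s' ! l - 1])"
    show "\<not> monochromatic ?Q (s'[l := s' ! l - 1] ! i) 2 f i"
      using 1 2 i nth unfolding avoids_def by (cases "i = l") (auto simp: s'_def)
  qed (use 1 in \<open>auto simp: avoids_def s'_def\<close>)
next
  case True
  with jl have fj: "f {v, u} = j" by (simp add: insert_commute)
  have 1: "avoids f (insert u ?Q) s' t" unfolding s'_def
    using j u fj by (intro avoids_neighbourhood[OF av _ _ _ u(2)]) auto
  show ?thesis
    using j True by (intro avoids_neighbourhood[OF 1, of _ _ u]) (auto simp: s'_def)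
qed

lemma avoidance_bound_small_entry:
  assumes "i < length s" "s ! i \<le> 1" "\<forall>\<^sub>F t in sequentially. g t \<ge> 0" "C \<ge> 0"
  shows "avoidance_bound s g C"
  unfolding avoidance_bound_def
  by (rule eventually_mono[OF assms(3)]) (use avoids_small_entry[OF _ assms(1,2)] assms(4) in fastforce)

lemma avoidance_bound_uniform:
  assumes "finite A" "\<And>a. a \<in> A \<Longrightarrow> \<exists>C\<ge>0. avoidance_bound (h a) g C"
    and g: "\<forall>\<^sub>F t in sequentially. g t \<ge> 0"
  obtains C where "C \<ge> 0" "\<And>a. a \<in> A \<Longrightarrow> avoidance_bound (h a) g C"
proof -
  from assms(2) obtain c where c: "\<And>a. a \<in> A \<Longrightarrow> c a \<ge> 0 \<and> avoidance_bound (h a) g (c a)" by metis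
  show ?thesis
  proof (rule that[of "sum c A"])
    show "sum c A \<ge> 0" using c by (intro sum_nonneg) auto
    fix a assume a: "a \<in> A"
    have le: "c a \<le> sum c A" using a c assms(1) by (intro member_le_sum) auto
    have "avoidance_bound (h a) g (c a)" using c a by auto
    with g show "avoidance_bound (h a) g (sum c A)" unfolding avoidance_bound_def
      by eventually_elim (meson le mult_right_mono order_trans)
  qed
qed

text \<open>From an entry 2 the truncated difference is already 0 and cannot drop, hence the bound
  3.\<close>

lemma sum_list_decrement:
  fixes s :: "nat list"
  assumes "j < length s" "s ! j \<ge> 3"
  shows "Suc (\<Sum>i<length s. s[j := s ! j - 1] ! i - 2) = (\<Sum>i<length s. s ! i - 2)"
proof -
  have "(\<Sum>i<length s. s[j := s ! j - 1] ! i - 2) = (s ! j - 3) + (\<Sum>i\<in>{..<length s} - {j}. s ! i - 2)"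
    using assms by (subst sum.remove[of _ j]) (auto intro!: sum.cong)
  moreover have "(\<Sum>i<length s. s ! i - 2) = (s ! j - 2) + (\<Sum>i\<in>{..<length s} - {j}. s ! i - 2)"
    using assms by (subst sum.remove[of _ j]) auto
  ultimately show ?thesis using assms by simp
qed

definition ramsey_scale :: "nat \<Rightarrow> nat \<Rightarrow> real" where
  "ramsey_scale S t = real t ^ (S + 1) / ln (real t) ^ S"

lemma ramsey_scale_Suc: "ramsey_scale (Suc S) t = ramsey_scale S t * real t / ln (real t)"
  by (simp add: ramsey_scale_def mult_ac)

lemma ramsey_scale_ge:
  assumes "t \<ge> 3"
  shows "ramsey_scale S t \<ge> real t"
proof (induction S)
  case (Suc S)
  have "ln (real t) > 0" "ln (real t) \<le> real t" using assms ln_le_minus_one[of "real t"] by auto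
  then have "1 \<le> real t / ln (real t)" by simp
  then have "real t * 1 \<le> ramsey_scale S t * (real t / ln (real t))"
    using Suc by (intro mult_mono) auto
  then show ?case by (simp add: ramsey_scale_Suc)
qed (simp add: ramsey_scale_def)

text \<open>Let \<open>u, w\<close> be adjacent neighbours of \<open>v\<close>, with \<open>vu\<close>, \<open>vw\<close>, \<open>uw\<close> coloured \<open>i, j, l\<close>. Unless
  \<open>j = l \<noteq> i\<close>, the vertex \<open>w\<close> lies in a set that is restricted in two colours (or twice in one)
  given \<open>v\<close> and \<open>u\<close>; if \<open>j = l \<noteq> i\<close>, then the same holds with \<open>u\<close> and \<open>w\<close> exchanged.\<close>
lemma neighbourhood_sparse:
  assumes f: "f \<in> nsets V 2 \<rightarrow> {..k}" and fin: "finite V" and v: "v \<in> V"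
    and X: "X \<subseteq> {u \<in> V. v \<noteq> u \<and> f {v, u} < k}"
    and Q: "\<And>u j l. u \<in> V \<Longrightarrow> u \<noteq> v \<Longrightarrow> j < k \<Longrightarrow> l < k \<Longrightarrow> j \<noteq> l \<or> f {u, v} = j \<Longrightarrow>
      real (card {w \<in> V - {u, v}. f {v, w} = j \<and> f {u, w} = l}) \<le> c"
    and c: "c \<ge> 0"
  shows "(\<Sum>u\<in>X. real (card {w \<in> X. u \<noteq> w \<and> f {u, w} < k})) \<le> 2 * real k ^ 2 * c * card X"
proof -
  \<comment> \<open>Orients each edge of \<open>X\<close> towards an endpoint whose codegree set is
    restricted twice. Every edge is \<open>ok\<close> in at least one direction, which costs the
    factor 2; the factor \<open>k ^ 2\<close> counts the colour pairs \<open>(j, l)\<close>.\<close>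
  define ok where "ok u w \<longleftrightarrow> u \<noteq> w \<and> f {u, w} < k \<and> (f {v, w} \<noteq> f {u, w} \<or> f {u, v} = f {v, w})" for u w
  have finX: "finite X" using X fin finite_subset by fastforce
  have out: "real (card {w \<in> X. ok u w}) \<le> real k ^ 2 * c" if u: "u \<in> X" for u
  proof -
    let ?J = "{(j, l). j < k \<and> l < k \<and> (j \<noteq> l \<or> f {u, v} = j)}"
    let ?Q = "\<lambda>(j, l). {w \<in> V - {u, v}. f {v, w} = j \<and> f {u, w} = l}"
    have J: "?J \<subseteq> {..<k} \<times> {..<k}" by auto
    then have finJ: "finite ?J" by (rule finite_subset) auto
    have "{w \<in> X. ok u w} \<subseteq> (\<Union>p\<in>?J. ?Q p)"
    proof
      fix w assume w: "w \<in> {w \<in> X. ok u w}"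
      then have "(f {v, w}, f {u, w}) \<in> ?J" using X by (auto simp: ok_def)
      moreover have "w \<in> ?Q (f {v, w}, f {u, w})" using w X by (auto simp: ok_def)
      ultimately show "w \<in> (\<Union>p\<in>?J. ?Q p)" by blast
    qed
    then have "card {w \<in> X. ok u w} \<le> (\<Sum>p\<in>?J. card (?Q p))"
      using finJ fin by (intro order_trans[OF card_mono card_UN_le]) auto
    then have "real (card {w \<in> X. ok u w}) \<le> (\<Sum>p\<in>?J. real (card (?Q p)))"
      by (simp only: of_nat_le_iff flip: of_nat_sum)
    also have "\<dots> \<le> (\<Sum>p\<in>?J. c)"
    proof (intro sum_mono)
      fix p assume "p \<in> ?J"
      then obtain j l where "p = (j, l)" "j < k" "l < k" "j \<noteq> l \<or> f {u, v} = j" by blast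
      moreover have "u \<in> V" "u \<noteq> v" using X u by auto
      ultimately show "real (card (?Q p)) \<le> c" using Q[of u j l] by simp
    qed
    also have "\<dots> = real (card ?J) * c" by simp
    also have "\<dots> \<le> real k ^ 2 * c"
      using card_mono[OF _ J] c by (intro mult_right_mono) (auto simp: power2_eq_square simp flip: of_nat_mult)
    finally show ?thesis .
  qed
  have split: "real (card {w \<in> X. u \<noteq> w \<and> f {u, w} < k}) \<le> real (card {w \<in> X. ok u w}) + real (card {w \<in> X. ok w u})"
    if "u \<in> X" for u
  proof -
    have "{w \<in> X. u \<noteq> w \<and> f {u, w} < k} \<subseteq> {w \<in> X. ok u w} \<union> {w \<in> X. ok w u}"
      by (auto simp: ok_def insert_commute)
    then have "card {w \<in> X. u \<noteq> w \<and> f {u, w} < k} \<le> card {w \<in> X. ok u w} + card {w \<in> X. ok w u}"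
      using finX by (intro order_trans[OF card_mono card_Un_le]) auto
    then show ?thesis by simp
  qed
  have count: "(\<Sum>u\<in>X. real (card {w \<in> X. R u w})) = (\<Sum>u\<in>X. \<Sum>w\<in>X. if R u w then 1 else 0)" for R
    using finX by (intro sum.cong) (auto simp: sum.If_cases Int_def)
  have swap: "(\<Sum>u\<in>X. real (card {w \<in> X. ok w u})) = (\<Sum>u\<in>X. real (card {w \<in> X. ok u w}))"
    unfolding count by (rule sum.swap)
  have "(\<Sum>u\<in>X. real (card {w \<in> X. u \<noteq> w \<and> f {u, w} < k}))
      \<le> (\<Sum>u\<in>X. real (card {w \<in> X. ok u w}) + real (card {w \<in> X. ok w u}))"
    using split by (intro sum_mono)
  also have "\<dots> = 2 * (\<Sum>u\<in>X. real (card {w \<in> X. ok u w}))" by (simp add: sum.distrib swap)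
  also have "\<dots> \<le> 2 * (\<Sum>u\<in>X. real k ^ 2 * c)" using out by (intro mult_left_mono sum_mono) auto
  finally show ?thesis by (simp add: mult_ac)
qed

text \<open>All pairs inside such a \<open>W\<close> have the last colour.\<close>

lemma avoids_card_lt:
  assumes "avoids f V s t" "W \<subseteq> V" "independent_set (\<lambda>u w. u \<in> V \<and> w \<in> V \<and> u \<noteq> w \<and> f {u, w} < length s) W"
  shows "card W < t"
proof (rule ccontr)
  assume "\<not> card W < t"
  then obtain H where H: "H \<subseteq> W" "card H = t" "finite H"
    by (meson obtain_subset_with_card_n not_less)
  have "f e = length s" if eH: "e \<in> nsets H 2" for e
  proof -
    obtain x y where e: "e = {x, y}" "x \<noteq> y" "x \<in> H" "y \<in> H" using eH by (auto simp: nsets_2_eq)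
    then have "e \<in> nsets V 2" using H(1) assms(2) by auto
    then have "f e \<le> length s" using assms(1) by (auto simp: avoids_def)
    moreover have "x \<in> W" "y \<in> W" "x \<in> V" "y \<in> V" using e H(1) assms(2) by auto
    then have "\<not> f e < length s" using e(1,2) assms(3) unfolding independent_set_def by blast
    ultimately show ?thesis by simp
  qed
  moreover have "H \<in> nsets V t" using H assms(2) by (auto simp: nsets_def)
  ultimately have "monochromatic V t 2 f (length s)" unfolding monochromatic_def by blast
  then show False using assms(1) by (simp add: avoids_def)
qed

text \<open>\<open>one\<close> bounds the degree by \<open>D\<close> and \<open>two\<close> makes
  neighbourhoods sparse with parameter \<open>M\<close>. The true order of
  \<open>D / (4 * M)\<close> plays only through its logarithm, so the cruder bound
  \<open>sqrt t\<close> is enough: it gives \<open>ln t / 2\<close>, and an independent set of fewer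
  than \<open>t\<close> vertices forces \<open>card V \<le> 32 * D * t / ln t\<close>.\<close>

lemma avoidance_bound_step:
  fixes C1 C2 :: real
  assumes s: "\<And>i. i < length s \<Longrightarrow> s ! i \<ge> 2" and C: "C1 \<ge> 0" "C2 \<ge> 0"
    and one: "\<And>j. j < length s \<Longrightarrow> avoidance_bound (s[j := s ! j - 1]) (ramsey_scale S) C1"
    and two: "\<And>j l. j < length s \<Longrightarrow> l < length s \<Longrightarrow>
      avoidance_bound (s[j := s ! j - 1, l := s[j := s ! j - 1] ! l - 1])
        (\<lambda>t. ramsey_scale S t * ln (real t) / real t) C2"
  shows "avoidance_bound s (ramsey_scale (Suc S)) (32 * (length s * C1 + 1))"
proof -
  define k where "k = length s"
  \<comment> \<open>The summand 1 keeps \<open>D = K * U\<close> at least \<open>U\<close> even if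
    \<open>C1 = 0\<close>.\<close>
  define K where "K = k * C1 + 1"
  define E where "E = 8 * real k ^ 2 * C2"
  have K: "K \<ge> 1" and E: "E \<ge> 0" using C by (auto simp: K_def E_def)
  \<comment> \<open>\<open>4 * M\<close> equals \<open>E * U * ln t / t + 4\<close>. After
    multiplication by \<open>sqrt t\<close>, this condition puts the first summand below
    \<open>U / 2\<close>, and the next one does so for the second, because
    \<open>U \<ge> t\<close>.\<close>
  have "eventually (\<lambda>t. ln (real t) / sqrt (real t) < 1 / (2 * (E + 1))) sequentially"
  proof (rule order_tendstoD(2)[of _ 0])
    show "(\<lambda>t. ln (real t) / sqrt (real t)) \<longlonglongrightarrow> 0" by real_asymp
  qed (use E in simp)
  moreover have "eventually (\<lambda>t. 8 * sqrt (real t) \<le> real t) sequentially" by real_asymp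
  moreover have "eventually (\<lambda>t. t \<ge> 3) sequentially" by (rule eventually_ge_at_top)
  moreover have "\<forall>\<^sub>F t in sequentially. \<forall>j\<in>{..<k}. \<forall>V f. avoids f V (s[j := s ! j - 1]) t \<longrightarrow> real (card V) \<le> C1 * ramsey_scale S t"
    using one by (intro eventually_ball_finite) (auto simp: avoidance_bound_def k_def)
  moreover have "\<forall>\<^sub>F t in sequentially. \<forall>j\<in>{..<k}. \<forall>l\<in>{..<k}. \<forall>V f.
      avoids f V (s[j := s ! j - 1, l := s[j := s ! j - 1] ! l - 1]) t \<longrightarrow>
      real (card V) \<le> C2 * (ramsey_scale S t * ln (real t) / real t)"
    using two by (intro eventually_ball_finite ballI) (auto simp: avoidance_bound_def k_def)
  ultimately show ?thesis unfolding avoidance_bound_def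
  proof eventually_elim
    case (elim t)
    show ?case
    proof (intro allI impI)
      fix V f assume av: "avoids f V s t"
      define U where "U = ramsey_scale S t"
      define adj where "adj u w \<longleftrightarrow> u \<in> V \<and> w \<in> V \<and> u \<noteq> w \<and> f {u, w} < k" for u w
      define c where "c = C2 * (U * ln (real t) / real t)"
      define D where "D = K * U"
      define M where "M = 2 * real k ^ 2 * c + 1"
      have t: "real t \<ge> 3" "ln (real t) > 0" using elim(3) by auto
      have U: "U \<ge> real t" unfolding U_def using elim(3) by (rule ramsey_scale_ge)
      have fin: "finite V" and f: "f \<in> nsets V 2 \<rightarrow> {..k}" using av by (auto simp: avoids_def k_def)
      have c: "c \<ge> 0" using C t U by (simp add: c_def)
      have M: "M \<ge> 1" using c by (simp add: M_def)
      have deg: "real (card {u \<in> V. adj v u}) \<le> D" if v: "v \<in> V" for v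
      proof -
        have "{u \<in> V. adj v u} \<subseteq> (\<Union>j\<in>{..<k}. {u \<in> V - {v}. f {v, u} = j})" by (auto simp: adj_def)
        then have "card {u \<in> V. adj v u} \<le> (\<Sum>j<k. card {u \<in> V - {v}. f {v, u} = j})"
          using fin by (intro order_trans[OF card_mono card_UN_le]) auto
        then have "real (card {u \<in> V. adj v u}) \<le> (\<Sum>j<k. real (card {u \<in> V - {v}. f {v, u} = j}))"
          by (simp only: of_nat_le_iff flip: of_nat_sum)
        also have "\<dots> \<le> (\<Sum>j<k. C1 * U)"
        proof (intro sum_mono)
          fix j assume j: "j \<in> {..<k}"
          have "avoids f {u \<in> V - {v}. f {v, u} = j} (s[j := s ! j - 1]) t"
            using j s[of j] v by (intro avoids_neighbourhood[OF av, of _ _ v]) (auto simp: k_def)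
          then show "real (card {u \<in> V - {v}. f {v, u} = j}) \<le> C1 * U"
            using elim(4) j unfolding U_def by blast
        qed
        also have "\<dots> \<le> D" using U t by (simp add: D_def K_def algebra_simps)
        finally show ?thesis .
      qed
      have sparse: "(\<Sum>u\<in>X. real (card {w \<in> X. adj u w})) \<le> M * card X"
        if v: "v \<in> V" and X: "X \<subseteq> {u \<in> V. adj v u}" for v X
      proof -
        have "(\<Sum>u\<in>X. real (card {w \<in> X. adj u w})) = (\<Sum>u\<in>X. real (card {w \<in> X. u \<noteq> w \<and> f {u, w} < k}))"
          using X by (intro sum.cong refl arg_cong[of _ _ "\<lambda>A. real (card A)"]) (auto simp: adj_def)
        also have "\<dots> \<le> 2 * real k ^ 2 * c * card X"
        proof (rule neighbourhood_sparse[OF f fin v _ _ c])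
          show "X \<subseteq> {u \<in> V. v \<noteq> u \<and> f {v, u} < k}" using X by (auto simp: adj_def)
          fix u j l assume *: "u \<in> V" "u \<noteq> v" "j < k" "l < k" "j \<noteq> l \<or> f {u, v} = j"
          then have "avoids f {w \<in> V - {u, v}. f {v, w} = j \<and> f {u, w} = l}
             (s[j := s ! j - 1, l := s[j := s ! j - 1] ! l - 1]) t"
            using s v by (intro avoids_codegree[OF av]) (auto simp: k_def)
          then show "real (card {w \<in> V - {u, v}. f {v, w} = j \<and> f {u, w} = l}) \<le> c"
            using elim(5) *(3,4) unfolding c_def U_def by blast
        qed
        also have "\<dots> \<le> M * card X" by (simp add: M_def mult_right_mono)
        finally show ?thesis .
      qed
      have sqrt: "sqrt (real t) * sqrt (real t) = real t" "sqrt (real t) \<ge> 1" using t by auto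
      have ratio: "4 * M * sqrt (real t) \<le> D"
      proof -
        have "4 * M * sqrt (real t) = E * U * (ln (real t) * sqrt (real t) / real t) + 4 * sqrt (real t)"
          by (simp add: M_def E_def c_def algebra_simps)
        also have "ln (real t) * sqrt (real t) / real t = ln (real t) / sqrt (real t)"
          using sqrt t by (simp add: field_simps)
        also have "E * U * (ln (real t) / sqrt (real t)) \<le> E * U * (1 / (2 * (E + 1)))"
          using elim(1) E U t by (intro mult_left_mono) auto
        also have "\<dots> = U / 2 * (E / (E + 1))" using E by (simp add: field_simps)
        also have "\<dots> \<le> U / 2 * 1" using E U t by (intro mult_left_mono) auto
        also have "4 * sqrt (real t) \<le> U / 2" using elim(2) U by simp
        finally have "4 * M * sqrt (real t) \<le> U" by simp
        also have "\<dots> \<le> D" using K U t by (simp add: D_def)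
        finally show ?thesis by simp
      qed
      have DM: "4 * M \<le> D" using ratio sqrt(2) M
        by (smt (verit, best) mult_le_cancel_left1)
      have D: "D > 0" using DM M by simp
      have sym: "adj b a" if "adj a b" for a b using that by (auto simp: adj_def insert_commute)
      have irr: "\<not> adj a a" for a by (simp add: adj_def)
      obtain W where W: "W \<subseteq> V" "independent_set adj W"
          "card V * ln (D / (4 * M)) \<le> 16 * D * card W"
        by (rule independent_set_locally_sparse[of adj, OF sym irr fin M DM deg sparse])
      have "card W < t" using avoids_card_lt[OF av W(1)] W(2) by (simp add: adj_def[abs_def] k_def)
      have "sqrt (real t) \<le> D / (4 * M)" using ratio M by (simp add: field_simps)
      then have "ln (sqrt (real t)) \<le> ln (D / (4 * M))" using sqrt t by (intro ln_mono) auto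
      then have "ln (real t) / 2 \<le> ln (D / (4 * M))" using t by (simp add: ln_sqrt)
      then have "card V * (ln (real t) / 2) \<le> card V * ln (D / (4 * M))" by (rule mult_left_mono) simp
      also have "\<dots> \<le> 16 * D * card W" by fact
      also have "\<dots> \<le> 16 * D * t" using \<open>card W < t\<close> D by (intro mult_left_mono) auto
      finally have "card V \<le> 32 * D * t / ln (real t)" using t by (simp add: field_simps)
      then show "card V \<le> 32 * (length s * C1 + 1) * ramsey_scale (Suc S) t"
        unfolding D_def K_def k_def U_def ramsey_scale_Suc by (simp only: mult.assoc times_divide_eq_right)
    qed
  qed
qed

text \<open>The induction is a strong one because the codegree sets lead to lists of total
  \<open>S - 2\<close>. Lowering an entry 2 leaves the range of the induction, but then an entry is
  at most 1 and only \<open>V = {}\<close> remains. For \<open>S = 0\<close> all entries are 2, so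
  every pair of \<open>V\<close> has the last colour.\<close>

theorem avoidance_bound_exists:
  assumes "\<And>i. i < length s \<Longrightarrow> s ! i \<ge> 2" and "(\<Sum>i<length s. s ! i - 2) = S"
  shows "\<exists>C\<ge>0. avoidance_bound s (ramsey_scale S) C"
  using assms
proof (induction S arbitrary: s rule: less_induct)
  case (less S)
  have ev3: "eventually (\<lambda>t::nat. t \<ge> 3) sequentially" by (rule eventually_ge_at_top)
  have nonneg: "\<forall>\<^sub>F t in sequentially. ramsey_scale S' t \<ge> 0" for S'
    using ev3 by eventually_elim (rule order_trans[OF of_nat_0_le_iff ramsey_scale_ge])
  have nonneg': "\<forall>\<^sub>F t in sequentially. ramsey_scale S' t * ln (real t) / real t \<ge> 0" for S'
    using ev3 nonneg[of S'] by eventually_elim auto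
  show ?case
  proof (cases S)
    case 0
    then have s2: "s ! i = 2" if "i < length s" for i using less.prems that by (force simp: le_antisym)
    have "real (card V) \<le> 1 * ramsey_scale S t" if av: "avoids f V s t" for V f t
    proof -
      have "independent_set (\<lambda>u w. u \<in> V \<and> w \<in> V \<and> u \<noteq> w \<and> f {u, w} < length s) V"
        unfolding independent_set_def
      proof (intro ballI notI)
        fix u w assume *: "u \<in> V \<and> w \<in> V \<and> u \<noteq> w \<and> f {u, w} < length s"
        then have "{u, w} \<in> nsets V 2" "f ` nsets {u, w} 2 \<subseteq> {f {u, w}}" by auto
        then have "monochromatic V 2 2 f (f {u, w})" unfolding monochromatic_def by (rule bexI[rotated])
        moreover have "\<not> monochromatic V (s ! f {u, w}) 2 f (f {u, w})"
          using av * unfolding avoids_def by blast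
        ultimately show False using s2[of "f {u, w}"] * by simp
      qed
      then have "card V < t" using avoids_card_lt[OF av] by simp
      then show ?thesis by (simp add: 0 ramsey_scale_def)
    qed
    then have "avoidance_bound s (ramsey_scale S) 1" unfolding avoidance_bound_def by simp
    then show ?thesis by (intro exI[of _ 1]) simp
  next
    case (Suc S')
    let ?s1 = "\<lambda>j. s[j := s ! j - 1]"
    let ?s2 = "\<lambda>j l. s[j := s ! j - 1, l := s[j := s ! j - 1] ! l - 1]"
    \<comment> \<open>Agrees with the scale of total \<open>S' - 1\<close> once \<open>ln t\<close>
      is nonzero, by \<open>ramsey_scale_Suc\<close>.\<close>
    let ?g = "\<lambda>t. ramsey_scale S' t * ln (real t) / real t"
    have one: "\<exists>C\<ge>0. avoidance_bound (?s1 j) (ramsey_scale S') C" if j: "j \<in> {..<length s}" for j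
    proof (cases "s ! j \<ge> 3")
      case True
      then show ?thesis using less.prems j sum_list_decrement[of j s] Suc
        by (intro less.IH) (auto simp: nth_list_update)
    next
      case False
      then have "?s1 j ! j \<le> 1" using j by auto
      then show ?thesis using j nonneg
        by (intro exI[of _ 0] conjI avoidance_bound_small_entry[of j]) auto
    qed
    have two: "\<exists>C\<ge>0. avoidance_bound (?s2 j l) ?g C" if "(j, l) \<in> {..<length s} \<times> {..<length s}" for j l
    proof (cases "s ! j \<ge> 3 \<and> ?s1 j ! l \<ge> 3")
      case True
      have jl: "j < length s" "l < length s" using that by auto
      have sum: "Suc (Suc (\<Sum>i<length s. ?s2 j l ! i - 2)) = S"
        using sum_list_decrement[of j s] sum_list_decrement[of l "?s1 j"] True jl less.prems by simp
      then obtain S'' where S'': "S' = Suc S''" using Suc by auto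
      have "\<exists>C\<ge>0. avoidance_bound (?s2 j l) (ramsey_scale S'') C"
      proof (rule less.IH)
        show "S'' < S" using Suc S'' by simp
        fix i assume "i < length (?s2 j l)"
        then have i: "i < length s" by simp
        have "?s1 j ! i \<ge> 2" using less.prems(1)[OF i] True i by (cases "i = j") auto
        then show "?s2 j l ! i \<ge> 2" using conjunct2[OF True] i jl by (cases "i = l") simp_all
      qed (use sum Suc S'' in simp)
      then obtain C where C: "C \<ge> 0" "avoidance_bound (?s2 j l) (ramsey_scale S'') C" by auto
      have "avoidance_bound (?s2 j l) ?g C"
        using C(2) ev3 unfolding avoidance_bound_def
      proof eventually_elim
        case (elim t)
        then have "?g t = ramsey_scale S'' t" by (simp add: S'' ramsey_scale_Suc)
        then show ?case using elim by simp
      qed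
      then show ?thesis using C(1) by auto
    next
      case False
      have jl: "j < length s" "l < length s" using that by auto
      have "\<exists>i<length (?s2 j l). ?s2 j l ! i \<le> 1"
      proof (cases "s ! j \<ge> 3")
        case True
        then show ?thesis using False jl by (intro exI[of _ l]) auto
      next
        case f3: False
        then show ?thesis using jl by (intro exI[of _ j]) (auto simp: nth_list_update)
      qed
      then obtain i where "i < length (?s2 j l)" "?s2 j l ! i \<le> 1" by auto
      then show ?thesis using nonneg' by (intro exI[of _ 0] conjI avoidance_bound_small_entry[of i]) auto
    qed
    obtain C1 where C1: "C1 \<ge> 0" "\<And>j. j \<in> {..<length s} \<Longrightarrow> avoidance_bound (?s1 j) (ramsey_scale S') C1"
      using avoidance_bound_uniform[of "{..<length s}" ?s1, OF _ one nonneg] by auto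
    have two': "\<exists>C\<ge>0. avoidance_bound (?s2 (fst p) (snd p)) ?g C" if "p \<in> {..<length s} \<times> {..<length s}" for p
      using that by (intro two) auto
    obtain C2 where C2: "C2 \<ge> 0" "\<And>p. p \<in> {..<length s} \<times> {..<length s} \<Longrightarrow> avoidance_bound (?s2 (fst p) (snd p)) ?g C2"
      by (rule avoidance_bound_uniform[of "{..<length s} \<times> {..<length s}", OF _ two' nonneg'[of S']]) auto
    have "avoidance_bound s (ramsey_scale (Suc S')) (32 * (length s * C1 + 1))"
    proof (rule avoidance_bound_step[OF less.prems(1) C1(1) C2(1)])
      show "avoidance_bound (?s2 j l) ?g C2" if "j < length s" "l < length s" for j l
        using C2(2)[of "(j, l)"] that by simp
    qed (use C1(2) in auto)
    then show ?thesis using C1(1) Suc by (intro exI[of _ "32 * (length s * C1 + 1)"]) auto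
  qed
qed

theorem ramsey_number_upper_bound:
  assumes "\<And>i. i < length s \<Longrightarrow> s ! i \<ge> 2" and "(\<Sum>i<length s. s ! i - 2) = S"
  shows "\<exists>C>0. \<forall>\<^sub>F t in sequentially. real (ramsey_number (s @ [t])) \<le> C * ramsey_scale S t"
proof -
  obtain C where C: "C \<ge> 0" "avoidance_bound s (ramsey_scale S) C"
    using avoidance_bound_exists[OF assms] by auto
  have "\<forall>\<^sub>F t in sequentially. real (ramsey_number (s @ [t])) \<le> (C + 1) * ramsey_scale S t"
    using C(2) eventually_ge_at_top[of 3] unfolding avoidance_bound_def
  proof eventually_elim
    case (elim t)
    \<comment> \<open>Adding 1 puts \<open>N\<close> strictly above the avoidance bound and makes it
      positive, as \<open>ramsey_number\<close> requires. It is absorbed in \<open>C + 1\<close>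
      because the scale is at least 1.\<close>
    define N where "N = nat \<lfloor>C * ramsey_scale S t\<rfloor> + 1"
    have scale: "ramsey_scale S t \<ge> 1" using ramsey_scale_ge[OF elim(2), of S] elim(2) by simp
    have N: "real N > C * ramsey_scale S t" "real N \<le> C * ramsey_scale S t + 1"
      using C(1) scale unfolding N_def by (auto simp: of_nat_nat algebra_simps) linarith
    have "partn_lst {..<N} (s @ [t]) 2"
    proof (rule ccontr)
      assume "\<not> ?thesis"
      then obtain f where f: "f \<in> nsets {..<N} 2 \<rightarrow> {..<length (s @ [t])}"
        and no: "\<And>i. i < length (s @ [t]) \<Longrightarrow> \<not> monochromatic {..<N} ((s @ [t]) ! i) 2 f i"
        by (auto simp: partn_lst_def)
      have "avoids f {..<N} s t" unfolding avoids_def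
      proof (intro conjI allI impI)
        fix i assume "i < length s"
        then show "\<not> monochromatic {..<N} (s ! i) 2 f i" using no[of i] by (simp add: nth_append)
      next
        show "\<not> monochromatic {..<N} t 2 f (length s)" using no[of "length s"] by simp
      qed (use f in \<open>auto simp: less_Suc_eq_le\<close>)
      then show False using elim(1) N(1) by fastforce
    qed
    then have "ramsey_number (s @ [t]) \<le> N" unfolding ramsey_number_def by (intro Least_le) (simp add: N_def)
    then show ?case using N(2) scale by (simp add: algebra_simps)
  qed
  moreover have "C + 1 > 0" using C(1) by simp
  ultimately show ?thesis by blast
qed

section \<open>Counting independent tuples\<close>

text \<open>Tuples indexed by \<open>T\<close>, with repetitions allowed since random maps may
  collide. In a graph the case \<open>g x = g y\<close> imposes nothing, because a singleton is
  never an edge.\<close>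

definition independent_maps :: "nat set set \<Rightarrow> 'a set \<Rightarrow> nat set \<Rightarrow> ('a \<Rightarrow> nat) set" where
  "independent_maps E T B = {g \<in> T \<rightarrow>\<^sub>E B. \<forall>x\<in>T. \<forall>y\<in>T. {g x, g y} \<notin> E}"

lemma finite_independent_maps [simp, intro]:
  "finite T \<Longrightarrow> finite B \<Longrightarrow> finite (independent_maps E T B)"
  unfolding independent_maps_def by (rule finite_subset[of _ "T \<rightarrow>\<^sub>E B"]) (auto intro: finite_PiE)

lemma card_independent_maps_insert_le:
  assumes "finite T" "finite B" "x \<notin> T"
  shows "card (independent_maps E (insert x T) B) \<le> (\<Sum>v\<in>B. card (independent_maps E T {w \<in> B. {v, w} \<notin> E}))"
proof -
  let ?h = "\<lambda>g. (g x, g(x := undefined))"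
  let ?S = "SIGMA v:B. independent_maps E T {w \<in> B. {v, w} \<notin> E}"
  have "inj_on ?h (independent_maps E (insert x T) B)"
  proof (rule inj_onI)
    fix g g' assume "?h g = ?h g'"
    then have "g x = g' x" "g(x := undefined) = g'(x := undefined)" by auto
    then show "g = g'" by (metis fun_upd_triv fun_upd_upd)
  qed
  moreover have "?h ` independent_maps E (insert x T) B \<subseteq> ?S"
    using assms(3) by (auto simp: independent_maps_def PiE_def Pi_def extensional_def split: if_splits)
  moreover have "finite ?S" using assms by auto
  ultimately have "card (independent_maps E (insert x T) B) \<le> card ?S" by (rule card_inj_on_le)
  then show ?thesis using assms by (simp add: card_SigmaI)
qed

text \<open>The vertices of \<open>B\<close> with few neighbours in \<open>B\<close> number at most \<open>b = 2 l n / d\<close>; every other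
  choice of a vertex shrinks the set of candidates by a factor \<open>exp (- d / (2 n))\<close>.\<close>
lemma sum_candidates_powr_le:
  fixes l \<gamma> b :: real
  assumes G: "ndl_graph n d l E" and n: "n \<ge> 1" and d: "d > 0" and B: "B \<subseteq> {..<n}"
    and b: "b = 2 * \<bar>l\<bar> * n / d" and \<gamma>: "\<gamma> \<ge> 0" "exp (- (\<gamma> * d / (2 * n))) \<le> b / n"
  shows "(\<Sum>v\<in>B. real (card {w \<in> B. {v, w} \<notin> E}) powr \<gamma>) \<le> 2 * b * real (card B) powr \<gamma>"
proof -
  define X where "X = {v \<in> B. real (card {w \<in> B. {v, w} \<in> E}) < d * card B / (2 * n)}"
  have fin: "finite B" using B finite_subset by auto
  then have finX: "finite X" by (simp add: X_def)
  have XB: "X \<subseteq> B" and cardX: "card X \<le> card B" using fin by (auto simp: X_def intro: card_mono)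
  have b0: "b \<ge> 0" using b by simp
  have n0: "real n > 0" "real d > 0" using n d by auto
  have "real (card X) \<le> b"
  proof -
    \<comment> \<open>\<open>X\<close> sends to \<open>B\<close> at most half of the expected number
      of edges, so mixing gives \<open>r \<le> b\<close>; and \<open>r\<close> dominates
      \<open>card X\<close> because \<open>X\<close> is the smaller set.\<close>
    define r where "r = sqrt (real (card X) * real (card B))"
    have r2: "r * r = real (card X) * real (card B)" by (simp add: r_def)
    have "real d * card X * card B / n - \<bar>l\<bar> * r \<le> (\<Sum>v\<in>X. real (card {w \<in> B. {v, w} \<in> E}))"
      unfolding r_def using XB B by (intro expander_mixing_lower[OF G n]) auto
    also have "\<dots> \<le> (\<Sum>v\<in>X. d * card B / (2 * n))" by (intro sum_mono) (auto simp: X_def)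
    also have "\<dots> = real d * card X * card B / n / 2" by (simp add: mult_ac)
    finally have "real d * card X * card B / n / 2 \<le> \<bar>l\<bar> * r" by linarith
    then have "(real d / (2 * n) * r) * r \<le> \<bar>l\<bar> * r" using r2 by (simp add: mult.assoc)
    moreover have "real (card X) \<le> r"
      unfolding r_def using cardX by (intro real_le_rsqrt) (simp add: power2_eq_square mult_left_mono)
    ultimately show ?thesis
    proof (cases "r > 0")
      case True
      then have "real d / (2 * n) * r \<le> \<bar>l\<bar>"
        using \<open>(real d / (2 * n) * r) * r \<le> \<bar>l\<bar> * r\<close> by (rule mult_right_le_imp_le[rotated])
      then have "r \<le> b" using n0 by (simp add: b field_simps)
      with \<open>real (card X) \<le> r\<close> show ?thesis by simp
    qed (use b0 in auto)
  qed
  have "(\<Sum>v\<in>B. real (card {w \<in> B. {v, w} \<notin> E}) powr \<gamma>)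
     = (\<Sum>v\<in>X. real (card {w \<in> B. {v, w} \<notin> E}) powr \<gamma>) + (\<Sum>v\<in>B - X. real (card {w \<in> B. {v, w} \<notin> E}) powr \<gamma>)"
    using sum.subset_diff[OF XB fin] by (simp add: add.commute)
  also have "(\<Sum>v\<in>X. real (card {w \<in> B. {v, w} \<notin> E}) powr \<gamma>) \<le> (\<Sum>v\<in>X. real (card B) powr \<gamma>)"
    using fin \<gamma> by (intro sum_mono powr_mono2) (auto intro: card_mono)
  also have "\<dots> \<le> b * real (card B) powr \<gamma>" using \<open>real (card X) \<le> b\<close> by (simp add: mult_right_mono)
  \<comment> \<open>The choice of \<open>\<gamma>\<close> turns one shrinking step into a factor
    \<open>b / n\<close>, so that up to \<open>n\<close> such vertices together cost no more than
    the exceptional ones.\<close>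
  also have "(\<Sum>v\<in>B - X. real (card {w \<in> B. {v, w} \<notin> E}) powr \<gamma>) \<le> (\<Sum>v\<in>B - X. real (card B) powr \<gamma> * (b / n))"
  proof (intro sum_mono)
    fix v assume "v \<in> B - X"
    then have v: "real (card {w \<in> B. {v, w} \<in> E}) \<ge> d * card B / (2 * n)" by (auto simp: X_def)
    have "card B = card {w \<in> B. {v, w} \<in> E} + card {w \<in> B. {v, w} \<notin> E}"
      using fin by (subst card_Un_disjoint[symmetric]) (auto intro: arg_cong[of _ _ card])
    then have "real (card {w \<in> B. {v, w} \<notin> E}) \<le> card B - d * card B / (2 * n)"
      using v by linarith
    also have "\<dots> = card B * (1 - d / (2 * n))" by (simp add: right_diff_distrib mult.commute)
    also have "\<dots> \<le> card B * exp (- (d / (2 * n)))"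
      using exp_ge_add_one_self[of "- (d / (2 * n))"] by (intro mult_left_mono) auto
    finally have "real (card {w \<in> B. {v, w} \<notin> E}) powr \<gamma> \<le> (card B * exp (- (d / (2 * n)))) powr \<gamma>"
      using \<gamma> by (intro powr_mono2) auto
    also have "\<dots> = real (card B) powr \<gamma> * exp (- (\<gamma> * d / (2 * n)))"
      by (simp add: powr_mult exp_powr_real mult.commute)
    also have "\<dots> \<le> real (card B) powr \<gamma> * (b / n)" using \<gamma> by (intro mult_left_mono) auto
    finally show "real (card {w \<in> B. {v, w} \<notin> E}) powr \<gamma> \<le> real (card B) powr \<gamma> * (b / n)" .
  qed
  also have "\<dots> = real (card (B - X)) / n * (b * real (card B) powr \<gamma>)" by simp
  also have "\<dots> \<le> 1 * (b * real (card B) powr \<gamma>)"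
  proof (rule mult_right_mono)
    have "card (B - X) \<le> card {..<n}" using B by (intro card_mono) auto
    then show "real (card (B - X)) / n \<le> 1" using n0 by simp
  qed (use b0 in simp)
  finally show ?thesis by simp
qed

text \<open>The potential \<open>card B powr \<gamma>\<close> replaces a record of the steps at
  which the candidate set shrinks: every step costs the same factor \<open>2 * b\<close>. The
  induction starts from a one-element domain, because an empty domain has one map while
  \<open>0 powr \<gamma>\<close> is 0.\<close>

lemma card_independent_maps_le:
  fixes l \<gamma> b :: real
  assumes G: "ndl_graph n d l E" and n: "n \<ge> 1" and d: "d > 0"
    and b: "b = 2 * \<bar>l\<bar> * n / d" and \<gamma>: "\<gamma> \<ge> 0" "exp (- (\<gamma> * d / (2 * n))) \<le> b / n"
    and T: "finite T" "x \<notin> T" and B: "B \<subseteq> {..<n}"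
  shows "real (card (independent_maps E (insert x T) B)) \<le> (2 * b) ^ card T * n * real (card B) powr \<gamma>"
  using T B
proof (induction T arbitrary: x B rule: finite_induct)
  case empty
  have fin: "finite B" and le: "card B \<le> n" using empty finite_subset card_mono[of "{..<n}" B] by auto
  have "card (independent_maps E {x} B) \<le> (\<Sum>v\<in>B. card (independent_maps E ({} :: 'a set) {w \<in> B. {v, w} \<notin> E}))"
    using fin by (intro card_independent_maps_insert_le) auto
  also have "\<dots> = card B" by (simp add: independent_maps_def)
  finally have "real (card (independent_maps E {x} B)) \<le> card B" by simp
  also have "\<dots> \<le> n * real (card B) powr \<gamma>"
  proof (cases "card B = 0")
    case False
    then have "1 \<le> real (card B) powr \<gamma>" using \<gamma> by (intro ge_one_powr_ge_zero) auto
    then have "real n * 1 \<le> n * real (card B) powr \<gamma>" by (intro mult_left_mono) auto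
    then show ?thesis using le by simp
  qed simp
  finally show ?case by simp
next
  case (insert y T)
  have fin: "finite B" using insert.prems finite_subset[of B "{..<n}"] by auto
  have b0: "b \<ge> 0" using b by simp
  have "card (independent_maps E (insert x (insert y T)) B)
     \<le> (\<Sum>v\<in>B. card (independent_maps E (insert y T) {w \<in> B. {v, w} \<notin> E}))"
    using insert fin by (intro card_independent_maps_insert_le) auto
  then have "real (card (independent_maps E (insert x (insert y T)) B))
     \<le> (\<Sum>v\<in>B. real (card (independent_maps E (insert y T) {w \<in> B. {v, w} \<notin> E})))"
    by (simp only: of_nat_le_iff flip: of_nat_sum)
  also have "\<dots> \<le> (\<Sum>v\<in>B. (2 * b) ^ card T * n * real (card {w \<in> B. {v, w} \<notin> E}) powr \<gamma>)"
    using insert by (intro sum_mono insert.IH) auto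
  also have "\<dots> = (2 * b) ^ card T * n * (\<Sum>v\<in>B. real (card {w \<in> B. {v, w} \<notin> E}) powr \<gamma>)"
    by (simp add: sum_distrib_left)
  also have "\<dots> \<le> (2 * b) ^ card T * n * (2 * b * real (card B) powr \<gamma>)"
    using insert b0 by (intro mult_left_mono sum_candidates_powr_le[OF G n d _ b \<gamma>]) auto
  also have "\<dots> = (2 * b) ^ card (insert y T) * n * real (card B) powr \<gamma>"
    using insert by simp
  finally show ?case .
qed

section \<open>Random superposition of graphs\<close>

definition independent_under :: "nat set set \<Rightarrow> ('a \<Rightarrow> nat) \<Rightarrow> 'a set \<Rightarrow> bool" where
  "independent_under E f T \<longleftrightarrow> (\<forall>x\<in>T. \<forall>y\<in>T. {f x, f y} \<notin> E)"

lemma card_independent_extensions_le: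
  assumes fin: "finite A" "finite B" and T: "T \<subseteq> A"
  shows "card {f \<in> A \<rightarrow>\<^sub>E B. independent_under E f T} \<le> card (independent_maps E T B) * card B ^ (card A - card T)"
proof -
  let ?h = "\<lambda>f. (restrict f T, restrict f (A - T))"
  have finT: "finite T" using T fin finite_subset by auto
  have "inj_on ?h {f \<in> A \<rightarrow>\<^sub>E B. independent_under E f T}"
  proof (rule inj_onI)
    fix f g assume fg: "f \<in> {f \<in> A \<rightarrow>\<^sub>E B. independent_under E f T}" "g \<in> {f \<in> A \<rightarrow>\<^sub>E B. independent_under E f T}"
      and h: "?h f = ?h g"
    show "f = g"
    proof (rule PiE_ext[of f A "\<lambda>_. B" g])
      fix x assume "x \<in> A"
      then show "f x = g x" using h by (cases "x \<in> T") (auto dest!: fun_cong[of _ _ x])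
    qed (use fg in auto)
  qed
  moreover have "?h ` {f \<in> A \<rightarrow>\<^sub>E B. independent_under E f T} \<subseteq> independent_maps E T B \<times> ((A - T) \<rightarrow>\<^sub>E B)"
    using T by (auto simp: independent_maps_def independent_under_def)
  moreover have "finite (independent_maps E T B \<times> ((A - T) \<rightarrow>\<^sub>E B))"
    using fin finT by (intro finite_cartesian_product finite_PiE) auto
  ultimately have "card {f \<in> A \<rightarrow>\<^sub>E B. independent_under E f T} \<le> card (independent_maps E T B \<times> ((A - T) \<rightarrow>\<^sub>E B))"
    by (rule card_inj_on_le)
  also have "\<dots> = card (independent_maps E T B) * card B ^ (card A - card T)"
    using fin T finT by (simp add: card_cartesian_product card_PiE card_Diff_subset)
  finally show ?thesis .
qed

text \<open>First moment method: summing over all maps \<open>A\<close> to \<open>{..<n}\<close>,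
  each \<open>T\<close> is independent under at most a fraction \<open>P\<close> of them.\<close>

lemma exists_map_few_independent:
  fixes P :: real
  assumes A: "finite A" and F: "finite F" "\<And>T. T \<in> F \<Longrightarrow> T \<subseteq> A \<and> card T = t" and n: "n \<ge> 1"
    and P: "\<And>T. T \<in> F \<Longrightarrow> real (card (independent_maps E T {..<n})) \<le> P * real n ^ t"
  shows "\<exists>f \<in> A \<rightarrow>\<^sub>E {..<n}. real (card {T \<in> F. independent_under E f T}) \<le> P * card F"
proof (rule ccontr)
  let ?M = "A \<rightarrow>\<^sub>E {..<n}"
  assume "\<not> ?thesis"
  then have gt: "P * card F < real (card {T \<in> F. independent_under E f T})" if "f \<in> ?M" for f
    using that by force
  have finM: "finite ?M" using A by (intro finite_PiE) auto
  have cardM: "card ?M = n ^ card A" using A by (simp add: card_PiE)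
  then have "?M \<noteq> {}" using n by fastforce
  have "real n ^ card A * (P * card F) = (\<Sum>f\<in>?M. P * card F)" by (simp add: cardM)
  also have "\<dots> < (\<Sum>f\<in>?M. real (card {T \<in> F. independent_under E f T}))"
    using finM \<open>?M \<noteq> {}\<close> gt by (intro sum_strict_mono) auto
  also have "\<dots> = (\<Sum>f\<in>?M. \<Sum>T\<in>F. if independent_under E f T then 1 else 0)"
    using F by (intro sum.cong refl) (simp add: sum.If_cases Int_def)
  also have "\<dots> = (\<Sum>T\<in>F. \<Sum>f\<in>?M. if independent_under E f T then 1 else 0)" by (rule sum.swap)
  also have "\<dots> = (\<Sum>T\<in>F. real (card {f \<in> ?M. independent_under E f T}))"
    using finM by (intro sum.cong refl) (simp add: sum.If_cases Int_def)
  also have "\<dots> \<le> (\<Sum>T\<in>F. P * real n ^ card A)"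
  proof (intro sum_mono)
    fix T assume T: "T \<in> F"
    have le: "t \<le> card A" using F(2)[OF T] A card_mono by auto
    have "card {f \<in> ?M. independent_under E f T} \<le> card (independent_maps E T {..<n}) * n ^ (card A - t)"
      using card_independent_extensions_le[OF A, of "{..<n}" T E] F(2)[OF T] by simp
    then have "real (card {f \<in> ?M. independent_under E f T}) \<le> real (card (independent_maps E T {..<n})) * real n ^ (card A - t)"
      by (simp only: of_nat_le_iff flip: of_nat_mult of_nat_power)
    also have "\<dots> \<le> P * real n ^ t * real n ^ (card A - t)" using P[OF T] by (intro mult_right_mono) auto
    also have "\<dots> = P * real n ^ card A" using le by (simp add: mult.assoc flip: power_add)
    finally show "real (card {f \<in> ?M. independent_under E f T}) \<le> P * real n ^ card A" .
  qed
  also have "\<dots> = real n ^ card A * (P * card F)" by simp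
  finally show False by simp
qed

text \<open>The maps are chosen one colour at a time, each tested only on the sets that survived the
  earlier ones. The fractions then multiply, as they would for independent random maps.\<close>

lemma exists_maps_few_jointly_independent:
  fixes P :: "nat \<Rightarrow> real"
  assumes A: "finite A" and n: "\<And>i. i < k \<Longrightarrow> n i \<ge> (1::nat)" and P0: "\<And>i. i < k \<Longrightarrow> P i \<ge> 0"
    and P: "\<And>i T. i < k \<Longrightarrow> T \<subseteq> A \<Longrightarrow> card T = t \<Longrightarrow> real (card (independent_maps (E i) T {..<n i})) \<le> P i * real (n i) ^ t"
  shows "\<exists>f. (\<forall>i<k. f i \<in> A \<rightarrow>\<^sub>E {..<n i}) \<and>
    real (card {T \<in> nsets A t. \<forall>i<k. independent_under (E i) (f i) T}) \<le> (\<Prod>i<k. P i) * (card A choose t)"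
  using n P0 P
proof (induction k)
  case 0
  have "card (nsets A t) = card A choose t" using A n_subsets[OF A, of t]
    by (simp add: nsets_def finite_subset[OF _ A] conj_commute cong: conj_cong)
  then show ?case by simp
next
  case (Suc k)
  have "\<exists>f. (\<forall>i<k. f i \<in> A \<rightarrow>\<^sub>E {..<n i}) \<and>
    real (card {T \<in> nsets A t. \<forall>i<k. independent_under (E i) (f i) T}) \<le> (\<Prod>i<k. P i) * (card A choose t)"
  proof (rule Suc.IH)
    fix i assume "i < k"
    then have i: "i < Suc k" by simp
    show "n i \<ge> 1" "P i \<ge> 0" using Suc.prems(1,2)[OF i] by auto
    show "real (card (independent_maps (E i) T {..<n i})) \<le> P i * real (n i) ^ t"
      if "T \<subseteq> A" "card T = t" for T using Suc.prems(3)[OF i that] .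
  qed
  then obtain f where f: "\<forall>i<k. f i \<in> A \<rightarrow>\<^sub>E {..<n i}" and
    le: "real (card {T \<in> nsets A t. \<forall>i<k. independent_under (E i) (f i) T}) \<le> (\<Prod>i<k. P i) * (card A choose t)"
    by blast
  define F where "F = {T \<in> nsets A t. \<forall>i<k. independent_under (E i) (f i) T}"
  have "finite F" unfolding F_def using A by (simp add: finite_imp_finite_nsets)
  moreover have "T \<subseteq> A \<and> card T = t" if "T \<in> F" for T using that by (auto simp: F_def nsets_def)
  ultimately obtain h where h: "h \<in> A \<rightarrow>\<^sub>E {..<n k}"
    "real (card {T \<in> F. independent_under (E k) h T}) \<le> P k * card F"
    using exists_map_few_independent[OF A, of F t "n k" "E k" "P k"] Suc.prems by auto
  let ?f = "f(k := h)"
  have "{T \<in> nsets A t. \<forall>i<Suc k. independent_under (E i) (?f i) T} = {T \<in> F. independent_under (E k) h T}"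
    by (auto simp: F_def less_Suc_eq)
  then have "real (card {T \<in> nsets A t. \<forall>i<Suc k. independent_under (E i) (?f i) T}) \<le> P k * card F"
    using h by simp
  also have "\<dots> \<le> P k * ((\<Prod>i<k. P i) * (card A choose t))"
    using le Suc.prems(2)[of k] by (intro mult_left_mono) (auto simp: F_def)
  finally have "real (card {T \<in> nsets A t. \<forall>i<Suc k. independent_under (E i) (?f i) T})
      \<le> (\<Prod>i<Suc k. P i) * (card A choose t)" by (simp add: mult_ac)
  moreover have "\<forall>i<Suc k. ?f i \<in> A \<rightarrow>\<^sub>E {..<n i}" using f h by (auto simp: less_Suc_eq)
  ultimately show ?case by blast
qed

text \<open>A clique in a graph colour \<open>i\<close> cannot be collapsed by \<open>f i\<close>,
  since a collapsed pair is a singleton and thus no edge; its image would be a forbidden clique of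
  \<open>E i\<close>. A clique in the last colour would be independent under all maps.\<close>

lemma not_partn_lst_of_maps:
  assumes E: "\<And>i. i < length s \<Longrightarrow> graph_on (n i) (E i)"
    and free: "\<And>i. i < length s \<Longrightarrow> clique_free (s ! i) (n i) (E i)"
    and f: "\<And>i. i < length s \<Longrightarrow> f i \<in> A \<rightarrow> {..<n i}"
    and none: "\<And>T. T \<in> nsets A t \<Longrightarrow> \<exists>i<length s. \<not> independent_under (E i) (f i) T"
  shows "\<not> partn_lst A (s @ [t]) 2"
proof
  define k where "k = length s"
  \<comment> \<open>For a pair \<open>e\<close>, the set \<open>f i\<close> followed by
    \<open>e\<close> as image is the pair of image vertices; ties between colours go to the least
    index.\<close>
  define c where "c e = (if \<exists>i<k. f i ` e \<in> E i then LEAST i. i < k \<and> f i ` e \<in> E i else k)" for e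
  have c_less: "c e < k \<and> f (c e) ` e \<in> E (c e)" if "\<exists>i<k. f i ` e \<in> E i" for e
    using that LeastI_ex[of "\<lambda>i. i < k \<and> f i ` e \<in> E i"] by (auto simp: c_def)
  have c_eq: "(c e = k) \<longleftrightarrow> \<not> (\<exists>i<k. f i ` e \<in> E i)" for e
  proof (cases "\<exists>i<k. f i ` e \<in> E i")
    case True
    then have "c e < k" using c_less by blast
    with True show ?thesis by simp
  qed (auto simp: c_def)
  have c_le: "c e \<le> k" for e using c_less[of e] c_eq[of e] by (meson less_imp_le order_refl)
  assume "partn_lst A (s @ [t]) 2"
  moreover have "c \<in> nsets A 2 \<rightarrow> {..<length (s @ [t])}" using c_le by (auto simp: k_def less_Suc_eq_le)
  ultimately obtain i H where i: "i < length (s @ [t])" and H: "H \<in> nsets A ((s @ [t]) ! i)" "c ` nsets H 2 \<subseteq> {i}"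
    unfolding partn_lst_def monochromatic_def by blast
  have HA: "H \<subseteq> A" using H(1) by (auto simp: nsets_def)
  have col: "c {x, y} = i" if "x \<in> H" "y \<in> H" "x \<noteq> y" for x y
  proof -
    have "{x, y} \<in> nsets H 2" using that by simp
    then show ?thesis using H(2) by blast
  qed
  have loopless: "{a} \<notin> E j" if "j < k" for a j
    using E[of j] that by (auto simp: graph_on_def k_def nsets_def)
  show False
  proof (cases "i < k")
    case True
    have edge: "{f i x, f i y} \<in> E i" if "x \<in> H" "y \<in> H" "x \<noteq> y" for x y
      using col[OF that] c_less[of "{x, y}"] c_eq[of "{x, y}"] True by fastforce
    have inj: "inj_on (f i) H"
    proof (rule inj_onI, rule ccontr)
      fix x y assume "x \<in> H" "y \<in> H" "f i x = f i y" "x \<noteq> y"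
      then show False using edge[of x y] loopless[OF True, of "f i y"] by simp
    qed
    have "f i ` H \<in> nsets {..<n i} (s ! i)"
      using H(1) HA f[of i] True inj by (auto simp: nsets_def card_image nth_append k_def)
    moreover have "clique (f i ` H) (E i)" using edge by (auto simp: clique_def)
    ultimately show False using free[of i] True by (auto simp: clique_free_def k_def)
  next
    case False
    then have ik: "i = k" using i by (simp add: k_def)
    then have "H \<in> nsets A t" using H(1) by (simp add: k_def)
    then obtain j where j: "j < k" "\<not> independent_under (E j) (f j) H" using none by (auto simp: k_def)
    then obtain x y where xy: "x \<in> H" "y \<in> H" "{f j x, f j y} \<in> E j" by (auto simp: independent_under_def)
    then have "x \<noteq> y" using loopless[OF j(1)] by auto
    then have "c {x, y} = k" using col xy ik by auto
    then show False using c_eq[of "{x, y}"] j xy by auto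
  qed
qed

section \<open>Lower bound\<close>

text \<open>The ratio of \<open>l\<close> to \<open>d\<close> is of order
  \<open>n powr - \<sigma>\<close> with \<open>\<sigma> = (s - 2) * \<alpha>\<close>, which fixes
  \<open>2 * b\<close>. Shrinking needs \<open>\<gamma>\<close> of order
  \<open>(n / d) * ln n\<close>, that is \<open>n powr \<alpha> * ln n\<close>, and
  \<open>n powr \<gamma>\<close> supplies the second logarithm in the exponent.\<close>

lemma eventually_card_independent_maps_le:
  assumes W: "weakly_optimal_graphs_for_all_n s \<alpha>" and \<alpha>: "\<alpha> > 0" and s: "s \<ge> 2"
  shows "\<exists>K>0. \<exists>A\<ge>0. \<forall>\<^sub>F n in sequentially. \<exists>E. graph_on n E \<and> clique_free s n E \<and>
    (\<forall>T :: 'a set. finite T \<longrightarrow> T \<noteq> {} \<longrightarrow> real (card (independent_maps E T {..<n}))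
       \<le> (n * (K * n powr - (real (s - 2) * \<alpha>))) ^ card T * exp (A * (n powr \<alpha> * (ln n)\<^sup>2)))"
proof -
  obtain E d l where G: "\<And>n. n \<ge> 1 \<Longrightarrow> ndl_graph n (d n) (l n) (E n) \<and> clique_free s n (E n)"
    and d: "(\<lambda>n. real (d n)) \<in> \<Theta>(\<lambda>n. real n powr (1 - \<alpha>))"
    and l: "l \<in> \<Theta>(\<lambda>n. real n powr (1 - (real s - 1) * \<alpha>))"
    using W unfolding weakly_optimal_graphs_for_all_n_def by blast
  obtain c1 where c1: "c1 > 0" "\<forall>\<^sub>F n in sequentially. norm (real (d n)) \<ge> c1 * norm (real n powr (1 - \<alpha>))"
    using bigthetaD2[OF d] by (rule landau_omega.bigE)
  obtain c2 where c2: "c2 > 0" "\<forall>\<^sub>F n in sequentially. norm (real (d n)) \<le> c2 * norm (real n powr (1 - \<alpha>))"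
    using bigthetaD1[OF d] by (rule landau_o.bigE)
  obtain c3 where c3: "c3 > 0" "\<forall>\<^sub>F n in sequentially. norm (l n) \<ge> c3 * norm (real n powr (1 - (real s - 1) * \<alpha>))"
    using bigthetaD2[OF l] by (rule landau_omega.bigE)
  obtain c4 where c4: "c4 > 0" "\<forall>\<^sub>F n in sequentially. norm (l n) \<le> c4 * norm (real n powr (1 - (real s - 1) * \<alpha>))"
    using bigthetaD1[OF l] by (rule landau_o.bigE)
  define \<sigma> where "\<sigma> = real (s - 2) * \<alpha>"
  \<comment> \<open>Chosen so that \<open>\<gamma> * d / (2 * n)\<close> is at least
    \<open>(\<sigma> + 1) * ln n\<close> when
    \<open>d \<ge> c1 * n powr (1 - \<alpha>)\<close>.\<close>
  define A where "A = 2 * (\<sigma> + 1) / c1"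
  define K where "K = 4 * c4 / c1"
  have \<sigma>: "\<sigma> \<ge> 0" and A: "A \<ge> 0" and K: "K > 0" using \<alpha> c1 c4 by (auto simp: \<sigma>_def A_def K_def)
  have exponent: "1 - (real s - 1) * \<alpha> = (1 - \<alpha>) - \<sigma>" using s by (simp add: \<sigma>_def of_nat_diff algebra_simps)
  \<comment> \<open>The constant in the lower bound for \<open>b / n\<close> is absorbed by one
    extra factor \<open>n powr - 1\<close>, hence the exponent \<open>\<sigma> + 1\<close> in
    \<open>b_lower\<close>.\<close>
  have "\<forall>\<^sub>F n in sequentially. 2 * c3 / c2 \<ge> real n powr - 1"
  proof -
    have "(\<lambda>n. real n powr - 1) \<longlonglongrightarrow> 0" by real_asymp
    then have "\<forall>\<^sub>F n in sequentially. real n powr - 1 < 2 * c3 / c2"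
      by (rule order_tendstoD(2)) (use c2 c3 in simp)
    then show ?thesis by eventually_elim simp
  qed
  moreover have "\<forall>\<^sub>F n in sequentially. (n :: nat) \<ge> 3" by (rule eventually_ge_at_top)
  ultimately have "\<forall>\<^sub>F n in sequentially. graph_on n (E n) \<and> clique_free s n (E n) \<and>
    (\<forall>T :: 'a set. finite T \<longrightarrow> T \<noteq> {} \<longrightarrow> real (card (independent_maps (E n) T {..<n}))
       \<le> (n * (K * n powr - \<sigma>)) ^ card T * exp ((\<sigma> + 1 + A) * (n powr \<alpha> * (ln n)\<^sup>2)))"
    using c1(2) c2(2) c3(2) c4(2)
  proof eventually_elim
    case (elim n)
    have n: "real n > 0" "n \<ge> 1" using elim(2) by auto
    have lnn: "ln (real n) \<ge> 1"
    proof -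
      have "exp 1 \<le> real n" using e_less_272 elim(2) by linarith
      then show ?thesis using n by (simp add: ln_ge_iff)
    qed
    have p: "real n powr (1 - \<alpha>) > 0" using n by simp
    have dl: "c1 * real n powr (1 - \<alpha>) \<le> d n" using elim(3) by simp
    have du: "d n \<le> c2 * real n powr (1 - \<alpha>)" using elim(4) by simp
    have pw: "real n powr (1 - (real s - 1) * \<alpha>) = real n powr (1 - \<alpha>) * real n powr - \<sigma>"
      unfolding exponent by (simp flip: powr_add)
    have ll: "c3 * (real n powr (1 - \<alpha>) * real n powr - \<sigma>) \<le> \<bar>l n\<bar>"
      using elim(5) unfolding pw by (simp add: abs_mult)
    have lu: "\<bar>l n\<bar> \<le> c4 * (real n powr (1 - \<alpha>) * real n powr - \<sigma>)"
      using elim(6) unfolding pw by (simp add: abs_mult)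
    have dpos: "real (d n) > 0" using dl c1(1) p by (smt (verit) mult_pos_pos)
    define b where "b = 2 * \<bar>l n\<bar> * n / d n"
    define \<gamma> where "\<gamma> = A * (n powr \<alpha> * ln n)"
    have \<gamma>0: "\<gamma> \<ge> 0" using A lnn by (simp add: \<gamma>_def)
    have b_lower: "b / n \<ge> real n powr - (\<sigma> + 1)"
    proof -
      have "real n powr - (\<sigma> + 1) = real n powr (- 1 + - \<sigma>)" by (simp only: minus_add_distrib add.commute)
      also have "\<dots> = real n powr - 1 * real n powr - \<sigma>" by (rule powr_add)
      also have "\<dots> \<le> 2 * c3 / c2 * real n powr - \<sigma>" using elim(1) by (intro mult_right_mono) auto
      also have "\<dots> = 2 * (c3 * (real n powr (1 - \<alpha>) * real n powr - \<sigma>)) / (c2 * real n powr (1 - \<alpha>))"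
        using p c2 by simp
      also have "\<dots> \<le> 2 * \<bar>l n\<bar> / d n" using ll du dpos c3 p by (intro frac_le mult_left_mono) auto
      finally show ?thesis using n by (simp add: b_def)
    qed
    have b_upper: "2 * b \<le> n * (K * real n powr - \<sigma>)"
    proof -
      have "2 * \<bar>l n\<bar> / d n \<le> 2 * (c4 * (real n powr (1 - \<alpha>) * real n powr - \<sigma>)) / (c1 * real n powr (1 - \<alpha>))"
        using lu dl c1 c4 p by (intro frac_le mult_left_mono) auto
      also have "\<dots> = K / 2 * real n powr - \<sigma>" using p c1 by (simp add: K_def)
      finally have "(2 * n) * (2 * \<bar>l n\<bar> / d n) \<le> (2 * n) * (K / 2 * real n powr - \<sigma>)" by (intro mult_left_mono) auto
      then show ?thesis by (simp add: b_def mult_ac)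
    qed
    have \<gamma>: "exp (- (\<gamma> * d n / (2 * n))) \<le> b / n"
    proof -
      have "(\<sigma> + 1) * ln n = A * (n powr \<alpha> * ln n) * (c1 * real n powr (1 - \<alpha>)) / (2 * n)"
      proof -
        have "n powr \<alpha> * real n powr (1 - \<alpha>) = n" using n by (simp flip: powr_add)
        moreover have "A * (n powr \<alpha> * ln n) * (c1 * real n powr (1 - \<alpha>)) = A * c1 * ln n * (n powr \<alpha> * real n powr (1 - \<alpha>))"
          by (simp only: mult_ac)
        ultimately have "A * (n powr \<alpha> * ln n) * (c1 * real n powr (1 - \<alpha>)) = A * c1 * ln n * n" by simp
        then show ?thesis using n c1(1) by (simp only:) (simp add: A_def)
      qed
      also have "\<dots> \<le> \<gamma> * d n / (2 * n)"
        unfolding \<gamma>_def using dl A lnn by (intro divide_right_mono mult_left_mono) auto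
      finally have "exp (- (\<gamma> * d n / (2 * n))) \<le> exp (- ((\<sigma> + 1) * ln n))" by simp
      also have "\<dots> = real n powr - (\<sigma> + 1)" using n by (simp add: powr_def algebra_simps)
      finally show ?thesis using b_lower by linarith
    qed
    have G: "ndl_graph n (d n) (l n) (E n)" "clique_free s n (E n)" using G n by auto
    have "graph_on n (E n)" using G(1) by (auto simp: ndl_graph_def regular_graph_def)
    moreover have "real (card (independent_maps (E n) T {..<n}))
       \<le> (n * (K * n powr - \<sigma>)) ^ card T * exp ((\<sigma> + 1 + A) * (n powr \<alpha> * (ln n)\<^sup>2))"
      if T: "finite T" "T \<noteq> {}" for T :: "'a set"
    proof -
      obtain x where x: "x \<in> T" using T by auto
      have b0: "b \<ge> 0" by (simp add: b_def)
      \<comment> \<open>Trades the factor \<open>n\<close> left by the first vertex for one more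
        \<open>2 * b\<close>, completing the exponent \<open>card T\<close>.\<close>
      have n_le: "n \<le> 2 * b * n powr (\<sigma> + 1)"
      proof -
        have "1 = real n powr - (\<sigma> + 1) * n powr (\<sigma> + 1)" using n by (simp flip: powr_add)
        also have "\<dots> \<le> b / n * n powr (\<sigma> + 1)" using b_lower by (intro mult_right_mono) auto
        finally have "n \<le> b * n powr (\<sigma> + 1)" using n by (simp add: field_simps)
        also have "\<dots> \<le> 2 * b * n powr (\<sigma> + 1)" using b0 by (intro mult_right_mono) auto
        finally show ?thesis .
      qed
      have "real (card (independent_maps (E n) (insert x (T - {x})) {..<n}))
          \<le> (2 * b) ^ card (T - {x}) * n * real (card {..<n}) powr \<gamma>"
        using T dpos n G by (intro card_independent_maps_le[of n "d n" "l n"] b_def \<gamma>0 \<gamma>) auto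
      also have "\<dots> = (2 * b) ^ card (T - {x}) * n powr \<gamma> * n" by simp
      also have "\<dots> \<le> (2 * b) ^ card (T - {x}) * n powr \<gamma> * (2 * b * n powr (\<sigma> + 1))"
        using n_le b0 by (intro mult_left_mono) auto
      also have "\<dots> = (2 * b) ^ Suc (card (T - {x})) * (n powr \<gamma> * n powr (\<sigma> + 1))" by simp
      also have "Suc (card (T - {x})) = card T" using T(1) x by (rule card_Suc_Diff1)
      also have "n powr \<gamma> * n powr (\<sigma> + 1) = exp ((\<sigma> + 1 + \<gamma>) * ln n)"
        using n by (simp add: powr_def algebra_simps flip: exp_add)
      also have "insert x (T - {x}) = T" using x by auto
      finally have "real (card (independent_maps (E n) T {..<n})) \<le> (2 * b) ^ card T * exp ((\<sigma> + 1 + \<gamma>) * ln n)" .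
      also have "\<dots> \<le> (n * (K * n powr - \<sigma>)) ^ card T * exp ((\<sigma> + 1 + A) * (n powr \<alpha> * (ln n)\<^sup>2))"
      proof (rule mult_mono)
        show "(2 * b) ^ card T \<le> (n * (K * n powr - \<sigma>)) ^ card T"
          using b_upper b0 by (intro power_mono) auto
        have "1 * 1 \<le> n powr \<alpha> * ln n" using lnn n \<alpha> by (intro mult_mono ge_one_powr_ge_zero) auto
        then have "(\<sigma> + 1) * 1 \<le> (\<sigma> + 1) * (n powr \<alpha> * ln n)" using \<sigma> by (intro mult_left_mono) auto
        then have "(\<sigma> + 1 + \<gamma>) * ln n \<le> (\<sigma> + 1 + A) * (n powr \<alpha> * ln n) * ln n"
          using lnn by (intro mult_right_mono) (auto simp: \<gamma>_def algebra_simps)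
        then show "exp ((\<sigma> + 1 + \<gamma>) * ln n) \<le> exp ((\<sigma> + 1 + A) * (n powr \<alpha> * (ln n)\<^sup>2))"
          by (simp add: power2_eq_square mult.assoc)
      qed (use b_upper b0 K in auto)
      finally show ?thesis .
    qed
    ultimately show ?case using G by auto
  qed
  then have "\<forall>\<^sub>F n in sequentially. \<exists>E. graph_on n E \<and> clique_free s n E \<and>
    (\<forall>T :: 'a set. finite T \<longrightarrow> T \<noteq> {} \<longrightarrow> real (card (independent_maps E T {..<n}))
       \<le> (n * (K * n powr - \<sigma>)) ^ card T * exp ((\<sigma> + 1 + A) * (n powr \<alpha> * (ln n)\<^sup>2)))"
    by (rule eventually_mono) blast
  moreover have "\<sigma> + 1 + A \<ge> 0" using \<sigma> A by simp
  ultimately show ?thesis using K unfolding \<sigma>_def by blast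
qed

text \<open>\<open>P\<close> bounds the probability that a random map of a \<open>t\<close>-set into
  the host graph has independent image. The order \<open>n\<close> stays hidden, as only this ratio
  enters the superposition.\<close>

definition hosts_sparsely :: "nat \<Rightarrow> nat \<Rightarrow> real \<Rightarrow> bool" where
  "hosts_sparsely s t P \<longleftrightarrow> (\<exists>n\<ge>1. \<exists>E. graph_on n E \<and> clique_free s n E \<and>
    (\<forall>T :: nat set. card T = t \<longrightarrow> real (card (independent_maps E T {..<n})) \<le> P * real n ^ t))"

text \<open>Graphs of every order being available, \<open>n\<close> can be tied to \<open>t\<close>
  through \<open>n powr \<alpha>\<close> of order \<open>t / ln^2 t\<close>. The error is then
  exponential in \<open>t\<close>, and \<open>n powr - \<alpha>\<close> becomes a multiple of
  \<open>ln^2 t / t\<close>.\<close>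

lemma eventually_hosts_sparsely:
  assumes W: "weakly_optimal_graphs_for_all_n s \<alpha>" and \<alpha>: "\<alpha> > 0" and s: "s \<ge> 2"
  shows "\<exists>K>0. \<forall>\<^sub>F t in sequentially. hosts_sparsely s t ((K * ((ln t)\<^sup>2 / t) ^ (s - 2)) ^ t)"
proof -
  obtain K A where K: "K > 0" and A: "A \<ge> 0" and KA: "\<forall>\<^sub>F n in sequentially. \<exists>E. graph_on n E \<and> clique_free s n E \<and>
    (\<forall>T :: nat set. finite T \<longrightarrow> T \<noteq> {} \<longrightarrow> real (card (independent_maps E T {..<n}))
       \<le> (n * (K * n powr - (real (s - 2) * \<alpha>))) ^ card T * exp (A * (n powr \<alpha> * (ln n)\<^sup>2)))"
    using eventually_card_independent_maps_le[OF assms] by blast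
  define x where "x t = real t / (ln (real t))\<^sup>2" for t :: nat
  define m where "m t = nat \<lfloor>x t powr (1 / \<alpha>)\<rfloor>" for t
  have x_top: "filterlim x at_top sequentially" unfolding x_def by real_asymp
  have "filterlim (\<lambda>y::real. y powr (1 / \<alpha>)) at_top at_top" using \<alpha> by real_asymp
  then have xp_top: "filterlim (\<lambda>t. x t powr (1 / \<alpha>)) at_top sequentially"
    using x_top by (rule filterlim_compose)
  have "filterlim (\<lambda>y::real. nat \<lfloor>y\<rfloor>) at_top at_top" by real_asymp
  then have m_top: "filterlim m sequentially sequentially"
    unfolding m_def using xp_top by (rule filterlim_compose)
  \<comment> \<open>\<open>2 powr \<alpha>\<close> pays for rounding, which at most halves the real
    value behind \<open>n\<close>. The exponential comes from
    \<open>ln n \<le> ln t / \<alpha>\<close>.\<close>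
  define K' where "K' = K * (2 powr \<alpha>) ^ (s - 2) * exp (A / \<alpha>\<^sup>2)"
  have "K' > 0" using K by (simp add: K'_def)
  moreover have "\<forall>\<^sub>F t in sequentially. hosts_sparsely s t ((K' * ((ln t)\<^sup>2 / t) ^ (s - 2)) ^ t)"
    using eventually_compose_filterlim[OF KA m_top] xp_top[unfolded filterlim_at_top, rule_format, of 2]
      x_top[unfolded filterlim_at_top, rule_format, of 1] eventually_ge_at_top[of 3]
  proof eventually_elim
    case (elim t)
    define n where "n = m t"
    have t: "t \<ge> 3" "real t > 0" using elim(4) by auto
    have lnt: "ln (real t) \<ge> 1"
    proof -
      have "exp 1 \<le> real t" using e_less_272 t by linarith
      then show ?thesis using t by (simp add: ln_ge_iff)
    qed
    have x: "x t \<ge> 1" "x t \<le> t"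
    proof -
      have "1 \<le> (ln (real t))\<^sup>2" using lnt by simp
      then show "x t \<le> t" unfolding x_def using t by (simp add: divide_le_eq mult_le_cancel_left1)
    qed (use elim in simp)
    have n_bounds: "real n \<le> x t powr (1 / \<alpha>)" "x t powr (1 / \<alpha>) / 2 \<le> real n" "n \<ge> 1"
    proof -
      have "real n = of_int \<lfloor>x t powr (1 / \<alpha>)\<rfloor>" unfolding n_def m_def using elim(2) by (simp add: of_nat_nat)
      then show *: "real n \<le> x t powr (1 / \<alpha>)" "x t powr (1 / \<alpha>) / 2 \<le> real n"
        using elim(2) by linarith+
      have "real n \<ge> 1" using * elim(2) by linarith
      then show "n \<ge> 1" by simp
    qed
    have "real n powr \<alpha> \<le> (x t powr (1 / \<alpha>)) powr \<alpha>" using n_bounds \<alpha> by (intro powr_mono2) auto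
    also have "\<dots> = x t" using x \<alpha> by (simp add: powr_powr)
    finally have n_le: "real n powr \<alpha> \<le> x t" .
    have "x t / 2 powr \<alpha> = (x t powr (1 / \<alpha>) / 2) powr \<alpha>" using x \<alpha> by (simp add: powr_divide powr_powr)
    also have "\<dots> \<le> real n powr \<alpha>" using n_bounds \<alpha> by (intro powr_mono2) auto
    finally have n_ge: "x t / 2 powr \<alpha> \<le> real n powr \<alpha>" .
    have "\<alpha> * ln n = ln (n powr \<alpha>)" using n_bounds(3) by (simp add: ln_powr)
    also have "\<dots> \<le> ln t" using n_le x n_bounds(3) t by (subst ln_le_cancel_iff) auto
    finally have ln_le: "ln n \<le> ln t / \<alpha>" using \<alpha> by (simp add: field_simps)
    have "n powr \<alpha> * (ln n)\<^sup>2 \<le> x t * (ln t / \<alpha>)\<^sup>2"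
      using n_le ln_le n_bounds(3) x by (intro mult_mono power_mono) auto
    also have "\<dots> = t / \<alpha>\<^sup>2" using lnt by (simp add: x_def power_divide)
    finally have "exp (A * (n powr \<alpha> * (ln n)\<^sup>2)) \<le> exp (A * (t / \<alpha>\<^sup>2))" 
      using A by (simp only: exp_le_cancel_iff mult_left_mono)
    also have "\<dots> = exp (A / \<alpha>\<^sup>2) ^ t" by (simp add: mult.commute flip: exp_of_nat_mult)
    finally have exp_le: "exp (A * (n powr \<alpha> * (ln n)\<^sup>2)) \<le> exp (A / \<alpha>\<^sup>2) ^ t" .
    have "n powr - (real (s - 2) * \<alpha>) = (n powr - \<alpha>) ^ (s - 2)"
      using n_bounds(3) by (simp add: powr_powr mult.commute flip: powr_realpow)
    also have "\<dots> \<le> (2 powr \<alpha> * ((ln t)\<^sup>2 / t)) ^ (s - 2)"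
    proof (rule power_mono)
      have "n powr - \<alpha> = 1 / n powr \<alpha>" by (simp add: powr_minus divide_inverse)
      also have "\<dots> \<le> 1 / (x t / 2 powr \<alpha>)" using n_ge x n_bounds(3) by (intro divide_left_mono mult_pos_pos) auto
      finally show "n powr - \<alpha> \<le> 2 powr \<alpha> * ((ln t)\<^sup>2 / t)" by (simp add: x_def mult.commute)
    qed simp
    also have "\<dots> = (2 powr \<alpha>) ^ (s - 2) * ((ln t)\<^sup>2 / t) ^ (s - 2)" by (rule power_mult_distrib)
    finally have pow_le: "n powr - (real (s - 2) * \<alpha>) \<le> (2 powr \<alpha>) ^ (s - 2) * ((ln t)\<^sup>2 / t) ^ (s - 2)" .
    obtain E where E: "graph_on n E" "clique_free s n E"
      "\<And>T :: nat set. finite T \<Longrightarrow> T \<noteq> {} \<Longrightarrow> real (card (independent_maps E T {..<n}))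
       \<le> (n * (K * n powr - (real (s - 2) * \<alpha>))) ^ card T * exp (A * (n powr \<alpha> * (ln n)\<^sup>2))"
      using elim(1) unfolding n_def by blast
    have "real (card (independent_maps E T {..<n})) \<le> (K' * ((ln t)\<^sup>2 / t) ^ (s - 2)) ^ t * real n ^ t"
      if T: "card T = t" for T :: "nat set"
    proof -
      have "finite T" "T \<noteq> {}" using T t by (auto intro: card_ge_0_finite)
      then have "real (card (independent_maps E T {..<n}))
        \<le> (n * (K * n powr - (real (s - 2) * \<alpha>))) ^ t * exp (A * (n powr \<alpha> * (ln n)\<^sup>2))" using E(3) T by blast
      also have "\<dots> \<le> (n * (K * ((2 powr \<alpha>) ^ (s - 2) * ((ln t)\<^sup>2 / t) ^ (s - 2)))) ^ t * exp (A / \<alpha>\<^sup>2) ^ t"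
        using pow_le exp_le K by (intro mult_mono power_mono mult_left_mono) auto
      also have "\<dots> = (K' * ((ln t)\<^sup>2 / t) ^ (s - 2)) ^ t * real n ^ t"
        by (simp only: K'_def power_mult_distrib mult_ac)
      finally show ?thesis .
    qed
    then show ?case unfolding hosts_sparsely_def using E(1,2) n_bounds(3) by blast
  qed
  ultimately show ?thesis by blast
qed

text \<open>A single term of the exponential series gives
  \<open>t ^ t \<le> exp t * fact t\<close>.\<close>

lemma binomial_le_exp_power:
  assumes "t \<ge> 1"
  shows "real (N choose t) \<le> (exp 1 * N / t) ^ t"
proof -
  have "(\<Sum>i\<in>{t}. real t ^ i /\<^sub>R fact i) \<le> (\<Sum>i. real t ^ i /\<^sub>R fact i)"
    by (rule sum_le_suminf[OF summable_exp_generic]) auto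
  then have tt: "real t ^ t \<le> exp (real t) * fact t" by (simp add: exp_def divide_simps mult.commute)
  have "real ((N choose t) * fact t) \<le> real (N ^ t)"
    using binomial_fact_pow[of N t] by (simp only: of_nat_le_iff)
  then have "real (N choose t) * fact t \<le> real N ^ t" by simp
  then have "real (N choose t) * fact t * real t ^ t \<le> real N ^ t * (exp (real t) * fact t)"
    using tt by (intro mult_mono) auto
  then have "fact t * (real (N choose t) * real t ^ t) \<le> fact t * (real N ^ t * exp (real t))"
    by (simp add: mult_ac)
  then have "real (N choose t) * real t ^ t \<le> real N ^ t * exp (real t)"
    by (rule mult_left_le_imp_le) simp
  then have "real (N choose t) \<le> real N ^ t * exp (real t) / real t ^ t"
    using assms by (simp add: pos_le_divide_eq)
  also have "\<dots> = (exp 1 * N / t) ^ t"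
    using exp_of_nat_mult[of t "1::real"] by (simp add: power_mult_distrib power_divide)
  finally show ?thesis .
qed

text \<open>If \<open>N\<close> were smaller, the bound on the number of jointly independent
  \<open>t\<close>-sets would be below 1. Then some choice of maps leaves none, and superposition
  yields a colouring that contradicts the Ramsey property of \<open>N\<close>.\<close>

theorem ramsey_number_lower_bound:
  assumes s: "\<And>i. i < length s \<Longrightarrow> s ! i \<ge> 2" and S: "(\<Sum>i<length s. s ! i - 2) = S"
    and W: "\<And>i. i < length s \<Longrightarrow> \<exists>\<alpha>>0. weakly_optimal_graphs_for_all_n (s ! i) \<alpha>"
  shows "\<exists>c>0. \<forall>\<^sub>F t in sequentially. c * (real t ^ (S + 1) / ln (real t) ^ (2 * S)) \<le> real (ramsey_number (s @ [t]))"
proof -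
  define k where "k = length s"
  have "\<exists>K>0. \<forall>\<^sub>F t in sequentially. hosts_sparsely (s ! i) t ((K * ((ln t)\<^sup>2 / t) ^ (s ! i - 2)) ^ t)" if "i < k" for i
  proof -
    have i: "i < length s" using that by (simp add: k_def)
    then obtain \<alpha> where "\<alpha> > 0" "weakly_optimal_graphs_for_all_n (s ! i) \<alpha>" using W by blast
    then show ?thesis using eventually_hosts_sparsely[OF _ _ s[OF i]] by simp
  qed
  then have "\<exists>K. \<forall>i\<in>{..<k}. K i > 0 \<and>
    (\<forall>\<^sub>F t in sequentially. hosts_sparsely (s ! i) t ((K i * ((ln t)\<^sup>2 / t) ^ (s ! i - 2)) ^ t))"
    by (intro bchoice) auto
  then obtain K :: "nat \<Rightarrow> real" where K: "\<And>i. i < k \<Longrightarrow> K i > 0" and ev: "\<And>i. i < k \<Longrightarrow>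
    \<forall>\<^sub>F t in sequentially. hosts_sparsely (s ! i) t ((K i * ((ln t)\<^sup>2 / t) ^ (s ! i - 2)) ^ t)"
    by auto
  \<comment> \<open>Makes the base of the \<open>t\<close>-th power in the first moment bound at
    most \<open>1 / 2\<close>.\<close>
  define c where "c = 1 / (2 * exp 1 * (\<Prod>i<k. K i))"
  have prodK: "(\<Prod>i<k. K i) > 0" using K by (intro prod_pos) auto
  then have c: "c > 0" by (simp add: c_def)
  have "\<forall>\<^sub>F t in sequentially. \<forall>i\<in>{..<k}. hosts_sparsely (s ! i) t ((K i * ((ln t)\<^sup>2 / t) ^ (s ! i - 2)) ^ t)"
    using ev by (intro eventually_ball_finite) auto
  then have "\<forall>\<^sub>F t in sequentially. c * (real t ^ (S + 1) / ln (real t) ^ (2 * S)) \<le> real (ramsey_number (s @ [t]))"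
    using eventually_ge_at_top[of 3]
  proof eventually_elim
    case (elim t)
    have t: "real t > 0" "t \<ge> 1" "ln (real t) > 0" using elim(2) by auto
    obtain n E where nE: "\<And>i. i < k \<Longrightarrow> n i \<ge> (1::nat)" "\<And>i. i < k \<Longrightarrow> graph_on (n i) (E i)"
      "\<And>i. i < k \<Longrightarrow> clique_free (s ! i) (n i) (E i)"
      "\<And>i T. i < k \<Longrightarrow> card (T :: nat set) = t \<Longrightarrow> real (card (independent_maps (E i) T {..<n i}))
       \<le> (K i * ((ln t)\<^sup>2 / t) ^ (s ! i - 2)) ^ t * real (n i) ^ t"
      using elim(1) unfolding hosts_sparsely_def by (metis lessThan_iff)
    define N where "N = ramsey_number (s @ [t])"
    \<comment> \<open>Ramsey's theorem makes the \<open>LEAST\<close> in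
      \<open>ramsey_number\<close> meaningful; \<open>Suc\<close> secures positivity.\<close>
    obtain N0 :: nat where "partn_lst {..<N0} (s @ [t]) 2" using ramsey_full by blast
    then have "partn_lst {..<Suc N0} (s @ [t]) 2" by (rule partn_lst_greater_resource) simp
    then have "\<exists>N::nat. N > 0 \<and> partn_lst {..<N} (s @ [t]) 2" by blast
    then have part: "partn_lst {..<N} (s @ [t]) 2"
      unfolding N_def ramsey_number_def by (rule LeastI2_ex) simp
    show ?case
    proof (rule ccontr)
      assume "\<not> ?thesis"
      then have "real N < c * (real t ^ (S + 1) / ln (real t) ^ (2 * S))" by (simp add: N_def)
      then have N: "real N * ln (real t) ^ (2 * S) < c * real t ^ (S + 1)" using t by (simp add: field_simps)
      define P where "P i = (K i * ((ln t)\<^sup>2 / t) ^ (s ! i - 2)) ^ t" for i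
      have P0: "P i \<ge> 0" if "i < k" for i using K[OF that] by (simp add: P_def)
      obtain f where f: "\<forall>i<k. f i \<in> {..<N} \<rightarrow>\<^sub>E {..<n i}"
        and le: "real (card {T \<in> nsets {..<N} t. \<forall>i<k. independent_under (E i) (f i) T}) \<le> (\<Prod>i<k. P i) * (card {..<N} choose t)"
        using exists_maps_few_jointly_independent[of "{..<N}" k n P t E] nE(1,4) P0 unfolding P_def by auto
      have "(\<Prod>i<k. P i) = ((\<Prod>i<k. K i) * ((ln t)\<^sup>2 / t) ^ S) ^ t"
        unfolding P_def prod_power_distrib[symmetric] prod.distrib power_sum[symmetric] k_def S by simp
      moreover have "real (N choose t) \<le> (exp 1 * N / t) ^ t" using t(2) by (rule binomial_le_exp_power)
      ultimately have "(\<Prod>i<k. P i) * (N choose t) \<le> ((\<Prod>i<k. K i) * ((ln t)\<^sup>2 / t) ^ S) ^ t * (exp 1 * N / t) ^ t"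
        using prodK by (simp add: mult_left_mono)
      also have "\<dots> = ((\<Prod>i<k. K i) * ((ln t)\<^sup>2 / t) ^ S * (exp 1 * N / t)) ^ t" by (simp only: power_mult_distrib)
      also have "\<dots> < 1"
      proof -
        have "(\<Prod>i<k. K i) * ((ln t)\<^sup>2 / t) ^ S * (exp 1 * N / t)
          = exp 1 * (\<Prod>i<k. K i) * (real N * ln (real t) ^ (2 * S)) / real t ^ (S + 1)"
          by (simp add: power_divide mult_ac flip: power_mult)
        also have "\<dots> \<le> exp 1 * (\<Prod>i<k. K i) * (c * real t ^ (S + 1)) / real t ^ (S + 1)"
          using N prodK by (intro divide_right_mono mult_left_mono) auto
        also have "\<dots> = 1 / 2" using t prodK unfolding c_def by (simp add: less_imp_neq[THEN not_sym] del: prod_zero_iff)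
        also have "(1 / 2 :: real) < 1" by simp
        finally have "(\<Prod>i<k. K i) * ((ln t)\<^sup>2 / t) ^ S * (exp 1 * N / t) < 1" .
        then show ?thesis using t(2) prodK by (intro power_less_one_iff[THEN iffD2]) auto
      qed
      finally have "card {T \<in> nsets {..<N} t. \<forall>i<k. independent_under (E i) (f i) T} = 0" using le by simp
      then have "{T \<in> nsets {..<N} t. \<forall>i<k. independent_under (E i) (f i) T} = {}"
        by (subst (asm) card_0_eq) (auto simp: finite_imp_finite_nsets)
      then have "\<exists>i<k. \<not> independent_under (E i) (f i) T" if "T \<in> nsets {..<N} t" for T using that by blast
      then have "\<not> partn_lst {..<N} (s @ [t]) 2"
        using nE f by (intro not_partn_lst_of_maps[of s n E f]) (auto simp: k_def PiE_def)
      then show False using part by simp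
    qed
  qed
  then show ?thesis using c by blast
qed

theorem theorem4:
  fixes k S :: nat and \<alpha> :: "real list"
  assumes "k \<ge> 1" and "length \<alpha> = k" and "\<forall>i<k. \<alpha> ! i > 0"
  shows "\<exists>c>0. \<exists>C>0. \<exists>t0::nat. \<forall>s :: nat list.
    length s = k \<longrightarrow>
    (\<forall>i<k. s ! i \<ge> 3) \<longrightarrow>
    S = (\<Sum>i<k. s ! i - 2) \<longrightarrow>
    (\<forall>i<k. weakly_optimal_graphs_for_all_n (s ! i) (\<alpha> ! i)) \<longrightarrow>
    (\<forall>t\<ge>t0.
       c * (real t ^ (S + 1) / ln (real t) ^ (2 * S)) \<le> real (ramsey_number (s @ [t])) \<and>
       real (ramsey_number (s @ [t])) \<le> C * (real t ^ (S + 1) / ln (real t) ^ S))"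
proof -
  \<comment> \<open>Each summand \<open>s ! i - 2\<close> is at most \<open>S\<close>, so the
    entries are at most \<open>S + 2\<close> and \<open>L\<close> is finite. Constants and
    thresholds found per list can therefore be made uniform.\<close>
  define L where "L = {s :: nat list. length s = k \<and> (\<forall>i<k. s ! i \<ge> 3) \<and> S = (\<Sum>i<k. s ! i - 2) \<and>
    (\<forall>i<k. weakly_optimal_graphs_for_all_n (s ! i) (\<alpha> ! i))}"
  define lo where "lo t = real t ^ (S + 1) / ln (real t) ^ (2 * S)" for t
  have "L \<subseteq> {s. set s \<subseteq> {..S + 2} \<and> length s = k}"
  proof
    fix s assume s: "s \<in> L"
    have "s ! i \<le> S + 2" if "i < k" for i
      using member_le_sum[of i "{..<k}" "\<lambda>i. s ! i - 2"] that s by (auto simp: L_def)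
    then show "s \<in> {s. set s \<subseteq> {..S + 2} \<and> length s = k}" using s by (auto simp: L_def in_set_conv_nth)
  qed
  then have finL: "finite L" by (rule finite_subset) (rule finite_lists_length_eq, simp)
  have "\<exists>c>0. \<forall>\<^sub>F t in sequentially. c * lo t \<le> real (ramsey_number (s @ [t]))" if s: "s \<in> L" for s
    unfolding lo_def
  proof (rule ramsey_number_lower_bound)
    fix i assume "i < length s"
    then have "i < k" using s by (simp add: L_def)
    then show "\<exists>\<alpha>>0. weakly_optimal_graphs_for_all_n (s ! i) \<alpha>" "s ! i \<ge> 2"
      using s assms(3) by (auto simp: L_def intro: order_trans[of 2 3])
  qed (use s in \<open>auto simp: L_def\<close>)
  then have "\<exists>c. \<forall>s\<in>L. c s > 0 \<and> (\<forall>\<^sub>F t in sequentially. c s * lo t \<le> real (ramsey_number (s @ [t])))"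
    by (intro bchoice) auto
  then obtain c where c: "\<And>s. s \<in> L \<Longrightarrow> c s > 0"
    "\<And>s. s \<in> L \<Longrightarrow> \<forall>\<^sub>F t in sequentially. c s * lo t \<le> real (ramsey_number (s @ [t]))" by auto
  have "\<exists>C>0. \<forall>\<^sub>F t in sequentially. real (ramsey_number (s @ [t])) \<le> C * ramsey_scale S t" if s: "s \<in> L" for s
  proof (rule ramsey_number_upper_bound)
    fix i assume "i < length s"
    then show "s ! i \<ge> 2" using s by (auto simp: L_def intro: order_trans[of 2 3])
  qed (use s in \<open>auto simp: L_def\<close>)
  then have "\<exists>C. \<forall>s\<in>L. C s > 0 \<and> (\<forall>\<^sub>F t in sequentially. real (ramsey_number (s @ [t])) \<le> C s * ramsey_scale S t)"
    by (intro bchoice) auto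
  then obtain C where C: "\<And>s. s \<in> L \<Longrightarrow> C s > 0"
    "\<And>s. s \<in> L \<Longrightarrow> \<forall>\<^sub>F t in sequentially. real (ramsey_number (s @ [t])) \<le> C s * ramsey_scale S t" by auto
  \<comment> \<open>The inserted 1 keeps \<open>Min\<close> and \<open>Max\<close> well defined when
    \<open>L\<close> is empty.\<close>
  define c0 where "c0 = Min (insert 1 (c ` L))"
  define C0 where "C0 = Max (insert 1 (C ` L))"
  have c0: "c0 > 0" and c0_le: "\<And>s. s \<in> L \<Longrightarrow> c0 \<le> c s" using finL c(1) by (auto simp: c0_def)
  have "1 \<le> C0" and C0_ge: "\<And>s. s \<in> L \<Longrightarrow> C s \<le> C0"
    unfolding C0_def using finL by (auto intro!: Max_ge)
  then have C0: "C0 > 0" by simp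
  have "\<forall>\<^sub>F t in sequentially. \<forall>s\<in>L. c s * lo t \<le> real (ramsey_number (s @ [t]))"
    using finL c(2) by (intro eventually_ball_finite) auto
  moreover have "\<forall>\<^sub>F t in sequentially. \<forall>s\<in>L. real (ramsey_number (s @ [t])) \<le> C s * ramsey_scale S t"
    using finL C(2) by (intro eventually_ball_finite) auto
  moreover have "\<forall>\<^sub>F t in sequentially. (t::nat) \<ge> 3" by (rule eventually_ge_at_top)
  ultimately have "\<forall>\<^sub>F t in sequentially. \<forall>s\<in>L. c0 * lo t \<le> real (ramsey_number (s @ [t])) \<and>
      real (ramsey_number (s @ [t])) \<le> C0 * ramsey_scale S t"
  proof eventually_elim
    case (elim t)
    have "lo t \<ge> 0" "ramsey_scale S t \<ge> 0" using elim(3) by (auto simp: lo_def ramsey_scale_def)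
    show ?case
    proof (intro ballI conjI)
      fix s assume s: "s \<in> L"
      have "c0 * lo t \<le> c s * lo t" using c0_le[OF s] \<open>lo t \<ge> 0\<close> by (rule mult_right_mono)
      then show "c0 * lo t \<le> real (ramsey_number (s @ [t]))" using elim(1) s by force
      have "C s * ramsey_scale S t \<le> C0 * ramsey_scale S t"
        using C0_ge[OF s] \<open>ramsey_scale S t \<ge> 0\<close> by (rule mult_right_mono)
      then show "real (ramsey_number (s @ [t])) \<le> C0 * ramsey_scale S t" using elim(2) s by force
    qed
  qed
  then obtain t0 where "\<forall>t\<ge>t0. \<forall>s\<in>L. c0 * lo t \<le> real (ramsey_number (s @ [t])) \<and>
      real (ramsey_number (s @ [t])) \<le> C0 * ramsey_scale S t"
    by (auto simp: eventually_sequentially)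
  then show ?thesis
    using c0 C0 unfolding lo_def ramsey_scale_def L_def
    by (intro exI[of _ c0] conjI exI[of _ C0] exI[of _ t0] allI impI) auto
qed

end
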